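(* Let $Q\ge1$ and $0<s<Q$. Let $(X,d_X,\mu)$ be a proper metric measure space that is locally $Q$-homogeneous and supports a local $Q$-Poincaré inequality, and let $\pi\colon X\to W$ be a locally David–Semmes $s$-regular map onto a proper metric space $W$. Let $Y$ be any metric space and $p>Q$. If $f\colon X\to Y$ is continuous and has an upper gradient in $L^p_{\mathrm{loc}}(X)$, then for each $\alpha\in\left(s,\frac{ps}{p-Q+s}\right]$, $$\dim\{a\in W:\dim f(\pi^{-1}(a))\ge\alpha\}\le (Q-s)-p\left(1-\frac{s}{\alpha}\right).$$
   Context: A metric measure space is a metric space with a Borel measure $\mu$ giving positive finite measure to nonempty open sets; proper means closed balls are compact. $\dim$ denotes Hausdorff dimension (the set with restricted metric). Locally $Q$-homogeneous: for every compact $K\subseteq X$ there are $R>0$, $C\ge1$ with $\mu(B(x,r_2))/r_2^Q\le C\mu(B(x,r_1))/r_1^Q$ for $x\in K$, $0<r_1\le r_2<R$. Upper gradient of a continuous $f\colon X\to Y$: Borel $g\colon X\to[0,\infty]$ with $d_Y(f(\gamma(0)),f(\gamma(1)))\le\int_\gamma g\,ds$ for all rectifiable curves $\gamma\colon[0,1]\to X$. Local $Q$-Poincaré inequality: for every compact $K$ there are $C,\sigma\ge1$, $R>0$ such that for every continuous $u\colon X\to\mathbb{R}$ with upper gradient $g$ and every ball $B$ centered in $K$ with radius $<R$, $\frac{1}{\mu(B)}\int_B|u-u_B|d\mu\le C\operatorname{diam}B(\frac{1}{\mu(\sigma B)}\int_{\sigma B}g^Q d\mu)^{1/Q}$. A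 surjection $\pi\colon X\to W$ between proper metric spaces is locally David–Semmes $s$-regular ($s\ge0$) if for every compact $K\subseteq X$, $\pi|_K$ is Lipschitz and there are $C\ge1$, $r_0>0$ such that for every ball $B\subseteq W$ of radius $r<r_0$, the set $\pi^{-1}(B)\cap K$ can be covered by at most $Cr^{-s}$ balls in $X$ of radius $Cr$. Then $(X,W,\pi)$ is called an $s$-foliation. *)

theory Defs
  imports "HOL-Analysis.Analysis"
begin

definition hd_term :: "real \<Rightarrow> 'a::metric_space set \<Rightarrow> real" where
  "hd_term s C = (if C = {} then 0 else if s = 0 then 1 else diameter C powr s)"

definition hausdorff_pre :: "real \<Rightarrow> real \<Rightarrow> 'a::metric_space set \<Rightarrow> ennreal" where
  "hausdorff_pre s \<delta> A =
     (INF C \<in> {C :: nat \<Rightarrow> 'a set. A \<subseteq> (\<Union>i. C i) \<and> (\<forall>i. bounded (C i) \<and> diameter (C i) \<le> \<delta>)}.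
        (\<Sum>i. ennreal (hd_term s (C i))))"

definition hausdorff_measure :: "real \<Rightarrow> 'a::metric_space set \<Rightarrow> ennreal" where
  "hausdorff_measure s A = (SUP \<delta> \<in> {0<..}. hausdorff_pre s \<delta> A)"

definition hausdorff_dim :: "'a::metric_space set \<Rightarrow> ereal" where
  "hausdorff_dim A = Inf {ereal s | s. 0 \<le> s \<and> hausdorff_measure s A = 0}"

definition curve_length :: "(real \<Rightarrow> 'a::metric_space) \<Rightarrow> real \<Rightarrow> real \<Rightarrow> ereal" where
  "curve_length \<gamma> a b =
     Sup {ereal (\<Sum>i<n. dist (\<gamma> (t i)) (\<gamma> (t (Suc i)))) | n t.
            t 0 = a \<and> t n = b \<and> (\<forall>i<n. t i \<le> t (Suc i))}"

definition rectifiable_curve :: "(real \<Rightarrow> 'a::metric_space) \<Rightarrow> bool" where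
  "rectifiable_curve \<gamma> \<longleftrightarrow> continuous_on {0..1} \<gamma> \<and> curve_length \<gamma> 0 1 < \<infinity>"

definition length_fun :: "(real \<Rightarrow> 'a::metric_space) \<Rightarrow> real \<Rightarrow> real" where
  "length_fun \<gamma> t = real_of_ereal (curve_length \<gamma> 0 (max 0 (min 1 t)))"

text \<open>Line integral of g along gamma with respect to arc length, as the
 Lebesgue--Stieltjes integral with respect to d s_gamma.\<close>
definition line_integral :: "('a::metric_space \<Rightarrow> ennreal) \<Rightarrow> (real \<Rightarrow> 'a) \<Rightarrow> ennreal" where
  "line_integral g \<gamma> = (\<integral>\<^sup>+ t \<in> {0..1}. g (\<gamma> t) \<partial>interval_measure (length_fun \<gamma>))"

definition upper_gradient ::
  "('a::metric_space \<Rightarrow> 'b::metric_space) \<Rightarrow> ('a \<Rightarrow> ennreal) \<Rightarrow> bool" where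
  "upper_gradient f g \<longleftrightarrow> g \<in> borel_measurable borel \<and>
     (\<forall>\<gamma>. rectifiable_curve \<gamma> \<longrightarrow>
        ennreal (dist (f (\<gamma> 0)) (f (\<gamma> 1))) \<le> line_integral g \<gamma>)"

text \<open>Real powers of extended nonnegative reals (for p > 0: infinity^p = infinity).\<close>
definition enn_powr :: "ennreal \<Rightarrow> real \<Rightarrow> ennreal" where
  "enn_powr x p = (if x = \<infinity> then \<infinity> else ennreal (enn2real x powr p))"

definition proper_space :: "'a::metric_space itself \<Rightarrow> bool" where
  "proper_space _ \<longleftrightarrow> (\<forall>(x::'a) r. compact (cball x r))"

definition metric_measure :: "'a::metric_space measure \<Rightarrow> bool" where
  "metric_measure \<mu> \<longleftrightarrow> sets \<mu> = sets borel \<and> space \<mu> = UNIV \<and>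
     (\<forall>U. open U \<and> U \<noteq> {} \<longrightarrow> 0 < emeasure \<mu> U \<and> emeasure \<mu> U < \<infinity>)"

definition locally_homogeneous :: "'a::metric_space measure \<Rightarrow> real \<Rightarrow> bool" where
  "locally_homogeneous \<mu> Q \<longleftrightarrow>
     (\<forall>K. compact K \<longrightarrow> (\<exists>R>0. \<exists>C\<ge>1. \<forall>x\<in>K. \<forall>r1 r2. 0 < r1 \<and> r1 \<le> r2 \<and> r2 < R \<longrightarrow>
        measure \<mu> (ball x r2) / r2 powr Q \<le> C * measure \<mu> (ball x r1) / r1 powr Q))"

definition ball_average :: "'a::metric_space measure \<Rightarrow> ('a \<Rightarrow> real) \<Rightarrow> 'a set \<Rightarrow> real" where
  "ball_average \<mu> u B = (\<integral>x\<in>B. u x \<partial>\<mu>) / measure \<mu> B"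

definition local_poincare :: "'a::metric_space measure \<Rightarrow> real \<Rightarrow> bool" where
  "local_poincare \<mu> Q \<longleftrightarrow>
     (\<forall>K. compact K \<longrightarrow> (\<exists>C\<ge>1. \<exists>\<sigma>\<ge>1. \<exists>R>0.
        \<forall>(u::'a \<Rightarrow> real) g. continuous_on UNIV u \<and> upper_gradient u g \<longrightarrow>
        (\<forall>c\<in>K. \<forall>r. 0 < r \<and> r < R \<longrightarrow>
           ennreal ((\<integral>x\<in>ball c r. \<bar>u x - ball_average \<mu> u (ball c r)\<bar> \<partial>\<mu>) / measure \<mu> (ball c r))
           \<le> ennreal (C * diameter (ball c r)) *
              enn_powr ((\<integral>\<^sup>+x\<in>ball c (\<sigma> * r). enn_powr (g x) Q \<partial>\<mu>) / emeasure \<mu> (ball c (\<sigma> * r)))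
                       (1 / Q))))"

definition locally_DS_regular :: "('a::metric_space \<Rightarrow> 'b::metric_space) \<Rightarrow> real \<Rightarrow> bool" where
  "locally_DS_regular \<pi> s \<longleftrightarrow> surj \<pi> \<and>
     (\<forall>K. compact K \<longrightarrow>
        (\<exists>L. \<forall>x\<in>K. \<forall>y\<in>K. dist (\<pi> x) (\<pi> y) \<le> L * dist x y) \<and>
        (\<exists>C\<ge>1. \<exists>r0>0. \<forall>w r. 0 < r \<and> r < r0 \<longrightarrow>
           (\<exists>F. finite F \<and> real (card F) \<le> C * r powr (-s) \<and>
                \<pi> -` ball w r \<inter> K \<subseteq> (\<Union>c\<in>F. ball c (C * r)))))"

definition Lp_loc :: "'a::metric_space measure \<Rightarrow> real \<Rightarrow> ('a \<Rightarrow> ennreal) \<Rightarrow> bool" where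
  "Lp_loc \<mu> p g \<longleftrightarrow> (\<forall>K. compact K \<longrightarrow> (\<integral>\<^sup>+x\<in>K. enn_powr (g x) p \<partial>\<mu>) < \<infinity>)"

end

theory Submission
  imports Defs
begin

text \<open>
  Telescoping the Poincare inequality over shrinking balls gives a Morrey estimate: the diameter
  of the image of a ball of radius \<open>r\<close> is at most \<open>C r\<^bsup>1 - Q/p\<^esup>\<close> times the \<open>L\<^sup>p\<close> norm of \<open>g\<close> on a
  dilated ball. Let \<open>K\<close> be compact and let \<open>E\<close> be the set of those \<open>w\<close> for which the image of the part
  of the fibre over \<open>w\<close> in \<open>K\<close> has \<open>a\<close>-dimensional Hausdorff content at least \<open>\<eta> > 0\<close>. A maximal
  \<open>r\<close>-separated subset of such a fibre has at most \<open>N r\<^bsup>-s\<^esup>\<close> points, so Hoelder's inequality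
  forces the \<open>g\<^bsup>p\<^esup>\<close>-energies of the balls around them to sum up to at least \<open>c r\<^bsup>b\<^esup>\<close>, where
  \<open>b = (Q - s) - p (1 - s/a)\<close>. The centres chosen in fibres over points of \<open>E\<close>
  at mutual distance at least \<open>L r\<close>, with \<open>L\<close> a Lipschitz constant of \<open>\<pi>\<close> on \<open>K\<close>, are jointly
  \<open>r\<close>-separated, so their balls overlap boundedly by doubling; as the total energy is finite,
  there are at most \<open>B r\<^bsup>-b\<^esup>\<close> such points of \<open>E\<close>. So \<open>E\<close> is null in
  every dimension above \<open>b\<close>, and the exceptional set of the theorem is a countable union of such
  sets \<open>E\<close> with \<open>a\<close> slightly below \<open>\<alpha>\<close>.
\<close>

section \<open>Hausdorff content, null sets and dimension\<close>

lemma hausdorff_pre_le_finite_cover: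
  fixes C :: "'i \<Rightarrow> 'a::metric_space set"
  assumes "finite I" "A \<subseteq> (\<Union>i\<in>I. C i)" "0 \<le> \<delta>"
    and "\<And>i. i \<in> I \<Longrightarrow> bounded (C i)" "\<And>i. i \<in> I \<Longrightarrow> diameter (C i) \<le> \<delta>"
  shows "hausdorff_pre s \<delta> A \<le> (\<Sum>i\<in>I. ennreal (hd_term s (C i)))"
proof -
  obtain h where h: "bij_betw h {0..<card I} I"
    using ex_bij_betw_nat_finite[OF assms(1)] by blast
  \<comment> \<open>Padding by the empty set turns the finite cover into a sequence at no cost,
    since \<open>hd_term s {} = 0\<close> even for \<open>s = 0\<close>.\<close>
  define D where "D k = (if k < card I then C (h k) else {})" for k
  have hI: "h k \<in> I" if "k < card I" for k
    using bij_betwE[OF h] that by auto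
  have cov: "A \<subseteq> (\<Union>k. D k)"
  proof
    fix x assume "x \<in> A"
    then obtain i where "i \<in> I" "x \<in> C i" using assms(2) by blast
    moreover obtain k where "k < card I" "h k = i"
      using h \<open>i \<in> I\<close> unfolding bij_betw_def by (metis atLeastLessThan_iff imageE)
    ultimately have "x \<in> D k" by (simp add: D_def)
    then show "x \<in> (\<Union>k. D k)" by blast
  qed
  have "hausdorff_pre s \<delta> A \<le> (\<Sum>k. ennreal (hd_term s (D k)))"
    unfolding hausdorff_pre_def
  proof (rule INF_lower, intro CollectI conjI allI)
    show "A \<subseteq> (\<Union>i. D i)" by (rule cov)
  next
    fix i show "bounded (D i)" "diameter (D i) \<le> \<delta>"
      using assms(3-5) hI by (auto simp: D_def)
  qed
  also have "\<dots> = (\<Sum>k\<in>{0..<card I}. ennreal (hd_term s (D k)))"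
    by (rule suminf_finite) (auto simp: D_def hd_term_def)
  also have "\<dots> = (\<Sum>k\<in>{0..<card I}. ennreal (hd_term s (C (h k))))"
    by (rule sum.cong) (auto simp: D_def)
  also have "\<dots> = (\<Sum>i\<in>I. ennreal (hd_term s (C i)))"
    by (rule sum.reindex_bij_betw[OF h])
  finally show ?thesis .
qed

lemma hausdorff_pre_antimono:
  assumes "\<delta> \<le> \<delta>'"
  shows "hausdorff_pre s \<delta>' A \<le> hausdorff_pre s \<delta> A"
  unfolding hausdorff_pre_def by (rule INF_superset_mono) (auto intro: order_trans[OF _ assms])

lemma hausdorff_pre_mono:
  assumes "A \<subseteq> B"
  shows "hausdorff_pre s \<delta> A \<le> hausdorff_pre s \<delta> B"
  unfolding hausdorff_pre_def by (rule INF_superset_mono) (use assms in auto)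

lemma hausdorff_measure_eq_0_iff:
  "hausdorff_measure s A = 0 \<longleftrightarrow> (\<forall>\<delta>>0. hausdorff_pre s \<delta> A = 0)"
  unfolding hausdorff_measure_def
  by (auto simp flip: bot_ennreal)

lemma hausdorff_measure_null_mono:
  assumes "hausdorff_measure s B = 0" "A \<subseteq> B"
  shows "hausdorff_measure s A = 0"
  using assms hausdorff_pre_mono[OF assms(2)] unfolding hausdorff_measure_eq_0_iff
  by (metis le_zero_eq)

text \<open>Each \<open>A n\<close> has a cover of cost below \<open>e * (1/2) ^ Suc n\<close>;
  \<open>prod_decode\<close> enumerates all these covers as one sequence, of total cost at most
  \<open>e\<close>.\<close>

lemma hausdorff_pre_UN_null:
  fixes A :: "nat \<Rightarrow> 'a::metric_space set"
  assumes "\<And>n. hausdorff_pre s \<delta> (A n) = 0"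
  shows "hausdorff_pre s \<delta> (\<Union>n. A n) = 0"
proof -
  have le: "hausdorff_pre s \<delta> (\<Union>n. A n) \<le> ennreal e" if "e > 0" for e
  proof -
    have "\<exists>C. A n \<subseteq> (\<Union>i. C i) \<and> (\<forall>i. bounded (C i) \<and> diameter (C i) \<le> \<delta>) \<and>
        (\<Sum>i. ennreal (hd_term s (C i))) < ennreal (e * (1/2) ^ Suc n)" for n
    proof -
      have "hausdorff_pre s \<delta> (A n) < ennreal (e * (1/2) ^ Suc n)"
        using assms \<open>e > 0\<close> by simp
      then show ?thesis unfolding hausdorff_pre_def INF_less_iff by auto
    qed
    then obtain C where C: "\<And>n. A n \<subseteq> (\<Union>i. C n i)"
      "\<And>n i. bounded (C n i)" "\<And>n i. diameter (C n i) \<le> \<delta>"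
      "\<And>n. (\<Sum>i. ennreal (hd_term s (C n i))) < ennreal (e * (1/2) ^ Suc n)" by metis
    define D where "D k = (case prod_decode k of (n, i) \<Rightarrow> C n i)" for k
    have "hausdorff_pre s \<delta> (\<Union>n. A n) \<le> (\<Sum>k. ennreal (hd_term s (D k)))"
      unfolding hausdorff_pre_def
    proof (rule INF_lower, intro CollectI conjI allI)
      show "(\<Union>n. A n) \<subseteq> (\<Union>k. D k)"
      proof
        fix x assume "x \<in> (\<Union>n. A n)"
        then obtain n i where "x \<in> C n i" using C(1) by blast
        then have "x \<in> D (prod_encode (n, i))" by (simp add: D_def)
        then show "x \<in> (\<Union>k. D k)" by blast
      qed
    next
      fix k show "bounded (D k)" "diameter (D k) \<le> \<delta>"
        using C(2,3) by (auto simp: D_def split: prod.split)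
    qed
    also have "\<dots> = (\<Sum>n. \<Sum>i. ennreal (hd_term s (C n i)))"
      using suminf_ennreal_2dimen[of "\<lambda>n. \<Sum>i. ennreal (hd_term s (C n i))" "\<lambda>(n, i). ennreal (hd_term s (C n i))"]
      by (simp add: D_def case_prod_beta comp_def)
    also have "\<dots> \<le> (\<Sum>n. ennreal (e * (1/2) ^ Suc n))"
      by (intro suminf_le less_imp_le C(4)) auto
    also have "\<dots> = ennreal e"
    proof (rule suminf_ennreal_eq)
      show "(\<lambda>n. e * (1/2) ^ Suc n) sums e"
        using sums_mult[OF power_half_series, of e] by simp
    qed (use \<open>e > 0\<close> in simp)
    finally show ?thesis .
  qed
  have "hausdorff_pre s \<delta> (\<Union>n. A n) \<le> 0"
    by (rule ennreal_le_epsilon) (simp add: le)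
  then show ?thesis by simp
qed

lemma hausdorff_measure_UN_null:
  fixes A :: "nat \<Rightarrow> 'a::metric_space set"
  assumes "\<And>n. hausdorff_measure s (A n) = 0"
  shows "hausdorff_measure s (\<Union>n. A n) = 0"
  unfolding hausdorff_measure_eq_0_iff
proof (intro allI impI)
  fix \<delta> :: real assume "0 < \<delta>"
  then show "hausdorff_pre s \<delta> (\<Union>n. A n) = 0"
    using assms by (intro hausdorff_pre_UN_null) (simp add: hausdorff_measure_eq_0_iff)
qed

lemma hausdorff_measure_pos_of_dim:
  assumes "0 \<le> s" "ereal s < hausdorff_dim A"
  shows "hausdorff_measure s A \<noteq> 0"
proof
  assume "hausdorff_measure s A = 0"
  then have "hausdorff_dim A \<le> ereal s"
    unfolding hausdorff_dim_def by (intro Inf_lower) (use assms(1) in blast)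
  with assms(2) show False by simp
qed

text \<open>Every \<open>b + e\<close> competes in the infimum defining the dimension. That infimum
  runs over exponents \<open>s \<ge> 0\<close> only, so a negative \<open>b\<close> could never be
  an upper bound; hence \<open>0 \<le> b\<close>.\<close>

lemma hausdorff_dim_le:
  assumes "0 \<le> b" "\<And>t. b < t \<Longrightarrow> hausdorff_measure t A = 0"
  shows "hausdorff_dim A \<le> ereal b"
proof (rule ereal_le_epsilon2)
  fix e :: real assume "0 < e"
  then have "hausdorff_measure (b + e) A = 0" "0 \<le> b + e" using assms by auto
  then show "hausdorff_dim A \<le> ereal b + ereal e"
    unfolding hausdorff_dim_def plus_ereal.simps by (intro Inf_lower) blast
qed

lemma hd_term_le:
  assumes "bounded C" "0 < s" "diameter C \<le> d" 
  shows "hd_term s C \<le> d powr s"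
  using assms diameter_ge_0[OF assms(1)] by (auto simp: hd_term_def intro: powr_mono2)

section \<open>Separated sets and nets\<close>

definition separated :: "real \<Rightarrow> 'a::metric_space set \<Rightarrow> bool" where
  "separated r S \<longleftrightarrow> (\<forall>x\<in>S. \<forall>y\<in>S. x \<noteq> y \<longrightarrow> r \<le> dist x y)"

lemma separated_subset: "separated r S \<Longrightarrow> T \<subseteq> S \<Longrightarrow> separated r T"
  unfolding separated_def by blast

text \<open>The uniform bound on cardinalities yields a separated subset with the most points; a
  point of \<open>A\<close> at distance at least \<open>r\<close> from all of them could still be
  added, so the \<open>r\<close>-balls around them cover \<open>A\<close>.\<close>

lemma maximal_separated_net:
  fixes A :: "'a::metric_space set"
  assumes "0 < r"
    and bnd: "\<And>S. finite S \<Longrightarrow> S \<subseteq> A \<Longrightarrow> separated r S \<Longrightarrow> real (card S) \<le> B"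
  shows "\<exists>Z. finite Z \<and> Z \<subseteq> A \<and> separated r Z \<and> A \<subseteq> (\<Union>z\<in>Z. ball z r)"
proof -
  let ?P = "\<lambda>S. finite S \<and> S \<subseteq> A \<and> separated r S"
  have "?P {}" by (simp add: separated_def)
  moreover have "\<forall>S. ?P S \<longrightarrow> card S < Suc (nat \<lceil>B\<rceil>)"
  proof (intro allI impI)
    fix S assume "?P S"
    then have "real (card S) \<le> B" using bnd by blast
    also have "\<dots> \<le> real (nat \<lceil>B\<rceil>)" by (rule real_nat_ceiling_ge)
    finally show "card S < Suc (nat \<lceil>B\<rceil>)" by simp
  qed
  ultimately obtain Z where Z: "?P Z" and max: "\<forall>S. ?P S \<longrightarrow> card S \<le> card Z"
    using ex_has_greatest_nat[of ?P "{}" card "Suc (nat \<lceil>B\<rceil>)"] by auto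
  have "A \<subseteq> (\<Union>z\<in>Z. ball z r)"
  proof (rule ccontr)
    assume "\<not> ?thesis"
    then obtain x where x: "x \<in> A" "\<And>z. z \<in> Z \<Longrightarrow> r \<le> dist z x" by force
    then have "x \<notin> Z" using \<open>0 < r\<close> by force
    moreover have "?P (insert x Z)"
      using Z x by (auto simp: separated_def dist_commute)
    ultimately show False using max Z by (metis card_insert_disjoint Suc_n_not_le_n)
  qed
  with Z show ?thesis by blast
qed


section \<open>Masses of balls and packing under homogeneity\<close>

lemma diameter_le_dist:
  fixes S :: "'a::metric_space set"
  assumes "0 \<le> d" "\<And>x y. x \<in> S \<Longrightarrow> y \<in> S \<Longrightarrow> dist x y \<le> d"
  shows "diameter S \<le> d"
  using assms by (auto simp: diameter_def intro!: cSUP_least)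

lemma diameter_ball_le:
  fixes c :: "'a::metric_space"
  assumes "0 \<le> r"
  shows "diameter (ball c r) \<le> 2 * r"
proof (rule diameter_le_dist)
  fix x y assume "x \<in> ball c r" "y \<in> ball c r"
  then show "dist x y \<le> 2 * r"
    using dist_triangle2[of x y c] by (simp add: dist_commute)
qed (use assms in simp)

lemma metric_measure_sets: "metric_measure \<mu> \<Longrightarrow> sets \<mu> = sets borel"
  and metric_measure_space: "metric_measure \<mu> \<Longrightarrow> space \<mu> = UNIV"
  by (auto simp: metric_measure_def)

text \<open>\<open>UNIV\<close> is itself open and nonempty, so \<open>metric_measure\<close> forces
  the total mass to be finite.\<close>

lemma metric_measure_finite:
  assumes "metric_measure \<mu>"
  shows "finite_measure \<mu>"
proof
  show "emeasure \<mu> (space \<mu>) \<noteq> \<infinity>"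
    using assms unfolding metric_measure_def
    by (metis UNIV_not_empty infinity_ennreal_def less_irrefl open_UNIV)
qed

lemma metric_measure_ball_pos:
  assumes "metric_measure \<mu>" "0 < r"
  shows "0 < measure \<mu> (ball x r)"
proof -
  interpret finite_measure \<mu> by (rule metric_measure_finite[OF assms(1)])
  have "ball x r \<noteq> {}" using assms(2) by simp
  then have "0 < emeasure \<mu> (ball x r)"
    using assms(1) open_ball unfolding metric_measure_def by blast
  then show ?thesis
    by (simp add: emeasure_eq_measure)
qed

lemma metric_measure_ball_mono:
  assumes "metric_measure \<mu>" "ball x r \<subseteq> ball y t"
  shows "measure \<mu> (ball x r) \<le> measure \<mu> (ball y t)"
proof -
  interpret finite_measure \<mu> by (rule metric_measure_finite[OF assms(1)])
  show ?thesis using assms by (intro finite_measure_mono) (auto simp: metric_measure_sets)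
qed

lemma homogeneousE:
  assumes "locally_homogeneous \<mu> Q" "compact K"
  obtains R C where "0 < R" "1 \<le> C"
    "\<And>x r t. x \<in> K \<Longrightarrow> 0 < r \<Longrightarrow> r \<le> t \<Longrightarrow> t < R \<Longrightarrow>
      measure \<mu> (ball x t) \<le> C * (t / r) powr Q * measure \<mu> (ball x r)"
proof -
  obtain R C where RC: "0 < R" "1 \<le> C"
    "\<forall>x\<in>K. \<forall>r1 r2. 0 < r1 \<and> r1 \<le> r2 \<and> r2 < R \<longrightarrow>
        measure \<mu> (ball x r2) / r2 powr Q \<le> C * measure \<mu> (ball x r1) / r1 powr Q"
    using assms unfolding locally_homogeneous_def by blast
  show ?thesis
  proof (rule that[OF RC(1,2)])
    fix x r t assume *: "x \<in> K" "0 < r" "r \<le> t" "t < R"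
    then have "measure \<mu> (ball x t) / t powr Q \<le> C * measure \<mu> (ball x r) / r powr Q"
      using RC(3) by blast
    then show "measure \<mu> (ball x t) \<le> C * (t / r) powr Q * measure \<mu> (ball x r)"
      using * by (simp add: powr_divide field_simps)
  qed
qed

text \<open>Finitely many balls of radius \<open>R/4\<close> cover \<open>K\<close>. Their least
  mass bounds from below the mass of every ball of radius \<open>R/2\<close> around a point of
  \<open>K\<close>, and homogeneity carries this down to smaller radii.\<close>

lemma homogeneous_lower_bound:
  fixes \<mu> :: "'a::metric_space measure"
  assumes mm: "metric_measure \<mu>" and "locally_homogeneous \<mu> Q" "compact K"
  obtains c R where "0 < c" "0 < R"
    "\<And>x r. x \<in> K \<Longrightarrow> 0 < r \<Longrightarrow> r < R \<Longrightarrow> c * r powr Q \<le> measure \<mu> (ball x r)"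
proof -
  obtain R C where RC: "0 < R" "1 \<le> C"
    "\<And>x r t. x \<in> K \<Longrightarrow> 0 < r \<Longrightarrow> r \<le> t \<Longrightarrow> t < R \<Longrightarrow>
      measure \<mu> (ball x t) \<le> C * (t / r) powr Q * measure \<mu> (ball x r)"
    using homogeneousE[OF assms(2,3)] by metis
  obtain N where N: "finite N" "K \<subseteq> (\<Union>x\<in>N. ball x (R/4))"
    using \<open>compact K\<close> RC(1) unfolding compact_eq_totally_bounded
    by (metis divide_pos_pos zero_less_numeral)
  \<comment> \<open>The inserted 1 keeps the minimum defined and positive when \<open>N\<close> is
    empty.\<close>
  define m where "m = Min (insert 1 ((\<lambda>x. measure \<mu> (ball x (R/4))) ` N))"
  have "0 < m" unfolding m_def
    using N(1) RC(1) metric_measure_ball_pos[OF mm] by simp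
  have m: "m \<le> measure \<mu> (ball x (R/2))" if "x \<in> K" for x
  proof -
    obtain y where y: "y \<in> N" "x \<in> ball y (R/4)" using N(2) \<open>x \<in> K\<close> by blast
    have "m \<le> measure \<mu> (ball y (R/4))"
      unfolding m_def using N(1) y(1) by (intro Min_le) auto
    also have "\<dots> \<le> measure \<mu> (ball x (R/2))"
    proof (rule metric_measure_ball_mono[OF mm], rule subsetI)
      fix z assume "z \<in> ball y (R/4)"
      then show "z \<in> ball x (R/2)"
        using y(2) dist_triangle[of x z y] by (simp add: dist_commute)
    qed
    finally show ?thesis .
  qed
  let ?c = "m / (C * (R/2) powr Q)"
  show ?thesis
  proof (rule that[of ?c "R/2"])
    show "0 < ?c" "0 < R/2" using \<open>0 < m\<close> RC(1,2) by auto
    fix x r assume *: "x \<in> K" "0 < r" "r < R/2"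
    have "m \<le> C * ((R/2) / r) powr Q * measure \<mu> (ball x r)"
      using m[OF *(1)] RC(3)[of x r "R/2"] * RC(1) by simp
    also have "((R/2) / r) powr Q = (R/2) powr Q / r powr Q"
      by (rule powr_divide)
    finally have "m \<le> C * (R/2) powr Q * measure \<mu> (ball x r) / r powr Q" by simp
    then have "m * r powr Q \<le> C * (R/2) powr Q * measure \<mu> (ball x r)"
      using * by (simp add: pos_le_divide_eq)
    moreover have "0 < C * (R/2) powr Q" using RC(1,2) by simp
    ultimately show "?c * r powr Q \<le> measure \<mu> (ball x r)"
      by (simp add: pos_divide_le_eq mult.commute)
  qed
qed

text \<open>Packing by mass: the balls of radius \<open>r/2\<close> around the points of
  \<open>S\<close> are disjoint and lie in one large ball, whose mass is at most \<open>M\<close>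
  times the mass of each. As \<open>x\<close> may lie outside \<open>K\<close>, the large ball is
  centred at a point \<open>z0\<close> of \<open>S\<close>.\<close>

lemma separated_card_bound:
  fixes \<mu> :: "'a::metric_space measure" and K :: "'a set"
  assumes mm: "metric_measure \<mu>" and "locally_homogeneous \<mu> Q" "compact K" "0 < \<Lambda>"
  obtains M r0 where "0 < M" "0 < r0"
    "\<And>r x S. 0 < r \<Longrightarrow> r < r0 \<Longrightarrow> finite S \<Longrightarrow> S \<subseteq> K \<Longrightarrow> S \<subseteq> ball x (\<Lambda> * r) \<Longrightarrow> separated r S
      \<Longrightarrow> real (card S) \<le> M"
proof -
  interpret finite_measure \<mu> by (rule metric_measure_finite[OF mm])
  obtain R C where RC: "0 < R" "1 \<le> C"
    "\<And>x r t. x \<in> K \<Longrightarrow> 0 < r \<Longrightarrow> r \<le> t \<Longrightarrow> t < R \<Longrightarrow>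
      measure \<mu> (ball x t) \<le> C * (t / r) powr Q * measure \<mu> (ball x r)"
    using homogeneousE[OF assms(2,3)] by metis
  \<comment> \<open>\<open>8 * \<Lambda> + 2\<close> is the ratio of the radii
    \<open>(4 * \<Lambda> + 1) * r\<close> and \<open>r/2\<close> between which homogeneity is
    applied.\<close>
  define M where "M = C * (8 * \<Lambda> + 2) powr Q"
  have "0 < M" using RC(2) \<open>0 < \<Lambda>\<close> by (simp add: M_def)
  show ?thesis
  proof (rule that[of M "R / (4 * \<Lambda> + 1)"])
    show "0 < M" by fact
    show "0 < R / (4 * \<Lambda> + 1)" using RC(1) \<open>0 < \<Lambda>\<close> by simp
    fix r x S assume r: "0 < r" "r < R / (4 * \<Lambda> + 1)" and S: "finite S" "S \<subseteq> K"
      "S \<subseteq> ball x (\<Lambda> * r)" "separated r S"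
    show "real (card S) \<le> M"
    proof (cases "S = {}")
      case True
      then show ?thesis using \<open>0 < M\<close> by simp
    next
      case False
      then obtain z0 where z0: "z0 \<in> S" by blast
      have rR: "(4 * \<Lambda> + 1) * r < R" using r \<open>0 < \<Lambda>\<close> by (simp add: field_simps)
      have near: "dist z w < 2 * \<Lambda> * r" if "z \<in> S" "w \<in> S" for z w
      proof -
        have "dist x z < \<Lambda> * r" "dist x w < \<Lambda> * r" using S(3) that by auto
        then show ?thesis using dist_triangle2[of z w x] by (simp add: dist_commute)
      qed
      let ?V = "measure \<mu> (ball z0 ((2 * \<Lambda> + 1) * r))"
      have each: "?V \<le> M * measure \<mu> (ball z (r/2))" if "z \<in> S" for z
      proof -
        have "?V \<le> measure \<mu> (ball z ((4 * \<Lambda> + 1) * r))"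
        proof (rule metric_measure_ball_mono[OF mm], rule subsetI)
          fix y assume "y \<in> ball z0 ((2 * \<Lambda> + 1) * r)"
          then show "y \<in> ball z ((4 * \<Lambda> + 1) * r)"
            using near[OF that z0] dist_triangle[of z y z0] by (simp add: algebra_simps)
        qed
        also have "\<dots> \<le> C * (((4 * \<Lambda> + 1) * r) / (r/2)) powr Q * measure \<mu> (ball z (r/2))"
          using that S(2) r(1) rR \<open>0 < \<Lambda>\<close> by (intro RC(3)) (auto simp: algebra_simps)
        also have "((4 * \<Lambda> + 1) * r) / (r/2) = 8 * \<Lambda> + 2"
          using r(1) by (simp add: field_simps)
        finally show ?thesis unfolding M_def .
      qed
      have disj: "disjoint_family_on (\<lambda>z. ball z (r/2)) S"
      proof (unfold disjoint_family_on_def, intro ballI impI)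
        fix z w assume zw: "z \<in> S" "w \<in> S" "z \<noteq> w"
        then have "r \<le> dist z w" using S(4) unfolding separated_def by blast
        then show "ball z (r/2) \<inter> ball w (r/2) = {}"
          by (intro disjoint_ballI) simp
      qed
      have "real (card S) * ?V = (\<Sum>z\<in>S. ?V)" by simp
      also have "\<dots> \<le> (\<Sum>z\<in>S. M * measure \<mu> (ball z (r/2)))"
        by (intro sum_mono each)
      also have "\<dots> = M * measure \<mu> (\<Union>z\<in>S. ball z (r/2))"
        unfolding sum_distrib_left[symmetric]
        by (subst finite_measure_finite_Union[OF S(1) _ disj])
           (auto simp: metric_measure_sets[OF mm])
      also have "\<dots> \<le> M * ?V"
      proof (intro mult_left_mono finite_measure_mono subsetI)
        fix y assume "y \<in> (\<Union>z\<in>S. ball z (r/2))"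
        then obtain z where z: "z \<in> S" "dist z y < r/2" by auto
        show "y \<in> ball z0 ((2 * \<Lambda> + 1) * r)"
          using near[OF z0 z(1)] z(2) dist_triangle[of z0 y z] r(1) by (simp add: algebra_simps)
      qed (use \<open>0 < M\<close> in \<open>auto simp: metric_measure_sets[OF mm]\<close>)
      finally have "real (card S) * ?V \<le> M * ?V" .
      moreover have "0 < ?V"
        using r(1) \<open>0 < \<Lambda>\<close> by (intro metric_measure_ball_pos[OF mm]) simp
      ultimately show ?thesis by simp
    qed
  qed
qed

section \<open>Powers, and a threshold form of Hoelder's inequality\<close>

lemma borel_measurable_enn_powr:
  assumes "g \<in> borel_measurable M"
  shows "(\<lambda>x. enn_powr (g x) p) \<in> borel_measurable M"
proof -
  note [measurable] = assms
  show ?thesis unfolding enn_powr_def by measurable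
qed

lemma enn_powr_mono_ennreal:
  assumes "x \<le> ennreal y" "0 \<le> y" "0 \<le> p"
  shows "enn_powr x p \<le> ennreal (y powr p)"
proof -
  have "x \<noteq> \<infinity>" using assms(1) by (auto simp: top_unique)
  moreover have "enn2real x \<le> y" using assms by (simp add: enn2real_leI)
  ultimately show ?thesis
    using assms by (auto simp: enn_powr_def intro!: ennreal_leI powr_mono2)
qed

text \<open>Up to \<open>A\<close> the first term suffices; beyond it
  \<open>t powr (a - 1) \<le> A powr (a - 1)\<close>, the exponent being negative. As the bound is
  affine in \<open>t\<close>, it can be integrated or summed, and a suitable \<open>A\<close> then
  gives Hoelder's inequality up to a constant factor.\<close>

lemma powr_le_threshold:
  fixes t A a :: real
  assumes "0 \<le> t" "0 < A" "0 < a" "a < 1"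
  shows "t powr a \<le> A powr a + A powr (a - 1) * t"
proof (cases "t \<le> A")
  case True
  then have "t powr a \<le> A powr a" using assms by (intro powr_mono2) auto
  then show ?thesis using assms by (simp add: add_increasing2)
next
  case False
  then have "t powr a = t powr (a - 1) * t" using assms by (simp add: powr_diff)
  also have "\<dots> \<le> A powr (a - 1) * t"
    using False assms by (intro mult_right_mono powr_mono2') auto
  finally show ?thesis by (smt (verit) powr_ge_zero)
qed

text \<open>The real bound is applied to the \<open>p\<close>-th power with exponent
  \<open>q/p\<close>. At \<open>x = \<infinity>\<close> the right side is infinite as well, its
  coefficient being positive.\<close>

lemma enn_powr_le_threshold:
  assumes "0 < A" "0 < q" "q < p"
  shows "enn_powr x q \<le> ennreal (A powr (q/p)) + ennreal (A powr (q/p - 1)) * enn_powr x p"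
proof (cases "x = \<infinity>")
  case True
  then show ?thesis using assms by (simp add: enn_powr_def ennreal_mult_top)
next
  case False
  let ?t = "enn2real x"
  have "?t powr q = (?t powr p) powr (q/p)" using assms by (simp add: powr_powr)
  also have "\<dots> \<le> A powr (q/p) + A powr (q/p - 1) * ?t powr p"
    using assms by (intro powr_le_threshold) auto
  finally show ?thesis
    using False by (simp add: enn_powr_def ennreal_mult[symmetric] ennreal_plus[symmetric] del: ennreal_plus)
qed


section \<open>Averages over balls and the Poincare inequality in terms of
  \<open>p\<close>-energy\<close>

lemma set_integrable_continuous_ball:
  fixes u :: "'a::metric_space \<Rightarrow> real"
  assumes "proper_space TYPE('a)" "metric_measure \<mu>" "continuous_on UNIV u"
  shows "set_integrable \<mu> (ball c r) u"
proof -
  interpret finite_measure \<mu> by (rule metric_measure_finite[OF assms(2)])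
  have "compact (cball c r)" using assms(1) unfolding proper_space_def by blast
  then have "bounded (u ` cball c r)"
    by (intro compact_imp_bounded compact_continuous_image continuous_on_subset[OF assms(3)]) auto
  then obtain b where b: "\<And>x. x \<in> cball c r \<Longrightarrow> \<bar>u x\<bar> \<le> b"
    unfolding bounded_iff by (metis imageI real_norm_def)
  have "u \<in> borel_measurable \<mu>"
    using borel_measurable_continuous_onI[OF assms(3)]
      measurable_cong_sets[OF metric_measure_sets[OF assms(2)] refl] by blast
  then show ?thesis
    unfolding set_integrable_def
    by (intro integrable_const_bound[where B="max b 0"] borel_measurable_scaleR borel_measurable_indicator)
       (auto simp: indicator_def metric_measure_sets[OF assms(2)] intro!: AE_I2 b le_max_iff_disj[THEN iffD2])
qed

lemma ball_average_diff_le: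
  assumes "finite_measure \<mu>" "B \<in> sets \<mu>" "set_integrable \<mu> B u" "0 < measure \<mu> B"
  shows "\<bar>ball_average \<mu> u B - a\<bar> \<le> (\<integral>x\<in>B. \<bar>u x - a\<bar> \<partial>\<mu>) / measure \<mu> B"
proof -
  interpret finite_measure \<mu> by fact
  have ia: "set_integrable \<mu> B (\<lambda>x. a)"
    unfolding set_integrable_def using assms(2)
    by (intro integrable_scaleR_left integrable_real_indicator) (auto simp: less_top[symmetric])
  have "(\<integral>x\<in>B. u x - a \<partial>\<mu>) = (\<integral>x\<in>B. u x \<partial>\<mu>) - (\<integral>x\<in>B. a \<partial>\<mu>)"
    by (rule set_integral_diff(2)[OF assms(3) ia])
  also have "(\<integral>x\<in>B. a \<partial>\<mu>) = a * measure \<mu> B"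
    using assms(2) by (simp add: set_lebesgue_integral_def)
  finally have "ball_average \<mu> u B - a = (\<integral>x\<in>B. u x - a \<partial>\<mu>) / measure \<mu> B"
    unfolding ball_average_def using assms(4) by (simp add: field_simps)
  moreover have "\<bar>\<integral>x\<in>B. u x - a \<partial>\<mu>\<bar> \<le> (\<integral>x\<in>B. \<bar>u x - a\<bar> \<partial>\<mu>)"
    using set_integral_norm_bound[OF set_integral_diff(1)[OF assms(3) ia]] by simp
  ultimately show ?thesis
    using assms(4) by (simp add: abs_divide divide_right_mono)
qed

text \<open>The average over \<open>B'\<close> differs from that over \<open>B\<close> by at most
  the mean over \<open>B'\<close> of the deviation from the latter. Enlarging the domain of
  integration to \<open>B\<close> costs the ratio of the masses, at most \<open>D\<close>.\<close>

lemma ball_average_chain: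
  assumes "finite_measure \<mu>" "B \<in> sets \<mu>" "B' \<in> sets \<mu>" "B' \<subseteq> B" "set_integrable \<mu> B u"
    "0 < measure \<mu> B'" "measure \<mu> B \<le> D * measure \<mu> B'"
  shows "\<bar>ball_average \<mu> u B' - ball_average \<mu> u B\<bar>
    \<le> D * ((\<integral>x\<in>B. \<bar>u x - ball_average \<mu> u B\<bar> \<partial>\<mu>) / measure \<mu> B)"
proof -
  interpret finite_measure \<mu> by fact
  let ?a = "ball_average \<mu> u B"
  have ia: "set_integrable \<mu> B (\<lambda>x. ?a)"
    unfolding set_integrable_def using assms(2)
    by (intro integrable_scaleR_left integrable_real_indicator) (auto simp: less_top[symmetric])
  have i: "set_integrable \<mu> B (\<lambda>x. \<bar>u x - ?a\<bar>)"
    by (intro set_integrable_abs set_integral_diff(1) assms(5) ia)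
  have le: "measure \<mu> B' \<le> measure \<mu> B" by (intro finite_measure_mono assms)
  have "\<bar>ball_average \<mu> u B' - ?a\<bar> \<le> (\<integral>x\<in>B'. \<bar>u x - ?a\<bar> \<partial>\<mu>) / measure \<mu> B'"
    using set_integrable_subset[OF assms(5,3,4)] assms by (intro ball_average_diff_le) auto
  also have "\<dots> \<le> (\<integral>x\<in>B. \<bar>u x - ?a\<bar> \<partial>\<mu>) / measure \<mu> B'"
  proof (intro divide_right_mono)
    have "integrable \<mu> (\<lambda>x. indicator B' x *\<^sub>R \<bar>u x - ?a\<bar>)"
      using set_integrable_subset[OF i assms(3,4)] unfolding set_integrable_def .
    then show "(\<integral>x\<in>B'. \<bar>u x - ?a\<bar> \<partial>\<mu>) \<le> (\<integral>x\<in>B. \<bar>u x - ?a\<bar> \<partial>\<mu>)"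
      using i assms(4) unfolding set_integrable_def set_lebesgue_integral_def
      by (intro integral_mono) (auto simp: indicator_def)
  qed simp
  also have "\<dots> \<le> D * ((\<integral>x\<in>B. \<bar>u x - ?a\<bar> \<partial>\<mu>) / measure \<mu> B)"
  proof -
    have "1 / measure \<mu> B' \<le> D / measure \<mu> B"
      using assms(6,7) le by (simp add: field_simps)
    moreover have "0 \<le> (\<integral>x\<in>B. \<bar>u x - ?a\<bar> \<partial>\<mu>)"
      by (simp add: set_lebesgue_integral_def)
    ultimately have "(\<integral>x\<in>B. \<bar>u x - ?a\<bar> \<partial>\<mu>) * (1 / measure \<mu> B') \<le> (\<integral>x\<in>B. \<bar>u x - ?a\<bar> \<partial>\<mu>) * (D / measure \<mu> B)"
      by (rule mult_left_mono)
    then show ?thesis by (simp add: mult.commute)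
  qed
  finally show ?thesis .
qed

text \<open>The partial telescoping sums are dominated by the geometric series, and the bound
  survives the limit. The intended \<open>v\<close> are averages over shrinking balls, with the
  value at the centre as limit.\<close>

lemma geometric_telescope:
  fixes v :: "nat \<Rightarrow> real"
  assumes "v \<longlonglongrightarrow> l" "\<And>k. \<bar>v (Suc k) - v k\<bar> \<le> e * q ^ k" "0 \<le> q" "q < 1" "0 \<le> e"
  shows "\<bar>l - v 0\<bar> \<le> e / (1 - q)"
proof (rule LIMSEQ_le_const2)
  show "(\<lambda>n. \<bar>v n - v 0\<bar>) \<longlonglongrightarrow> \<bar>l - v 0\<bar>"
    by (intro tendsto_intros assms(1))
  have "\<bar>v n - v 0\<bar> \<le> e / (1 - q)" for n
  proof -
    have "\<bar>v n - v 0\<bar> = \<bar>\<Sum>k<n. v (Suc k) - v k\<bar>" by (simp add: sum_lessThan_telescope)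
    also have "\<dots> \<le> (\<Sum>k<n. e * q ^ k)"
      by (rule order_trans[OF sum_abs sum_mono[OF assms(2)]])
    also have "\<dots> = e * (\<Sum>k<n. q ^ k)" by (simp add: sum_distrib_left)
    also have "\<dots> = e * ((1 - q ^ n) / (1 - q))"
      using assms(4) by (simp add: sum_gp_strict)
    also have "\<dots> \<le> e * (1 / (1 - q))"
      using assms(3-5) by (intro mult_left_mono divide_right_mono) auto
    finally show ?thesis by simp
  qed
  then show "\<exists>N. \<forall>n\<ge>N. \<bar>v n - v 0\<bar> \<le> e / (1 - q)" by blast
qed

text \<open>Since \<open>Q < p\<close>, Hoelder's inequality replaces the mean of the
  \<open>Q\<close>-th power of \<open>g\<close> by that of the \<open>p\<close>-th power, and the
  mass bound \<open>c0 * r powr Q\<close> turns this mean into \<open>I\<close> times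
  \<open>r powr (- Q)\<close>. Together with the diameter factor this leaves the exponent
  \<open>1 - Q/p\<close> on \<open>r\<close>.\<close>

lemma poincare_Lp:
  fixes \<mu> :: "'a::metric_space measure"
  assumes mm: "metric_measure \<mu>" and "locally_homogeneous \<mu> Q" "local_poincare \<mu> Q"
    and "compact K" "1 \<le> Q" "Q < p"
  obtains C \<sigma> R where "0 < C" "1 \<le> \<sigma>" "0 < R"
    "\<And>(u :: 'a \<Rightarrow> real) g c r I. continuous_on UNIV u \<Longrightarrow> upper_gradient u g \<Longrightarrow> c \<in> K \<Longrightarrow>
      0 < r \<Longrightarrow> r < R \<Longrightarrow> 0 < I \<Longrightarrow> (\<integral>\<^sup>+x\<in>ball c (\<sigma> * r). enn_powr (g x) p \<partial>\<mu>) \<le> ennreal I \<Longrightarrow>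
      (\<integral>x\<in>ball c r. \<bar>u x - ball_average \<mu> u (ball c r)\<bar> \<partial>\<mu>) / measure \<mu> (ball c r)
        \<le> C * r powr (1 - Q/p) * I powr (1/p)"
proof -
  interpret finite_measure \<mu> by (rule metric_measure_finite[OF mm])
  obtain C \<sigma> R where P: "1 \<le> C" "1 \<le> \<sigma>" "0 < R"
    and poincare: "\<And>(u :: 'a \<Rightarrow> real) g c r. continuous_on UNIV u \<Longrightarrow> upper_gradient u g \<Longrightarrow> c \<in> K \<Longrightarrow>
      0 < r \<Longrightarrow> r < R \<Longrightarrow>
           ennreal ((\<integral>x\<in>ball c r. \<bar>u x - ball_average \<mu> u (ball c r)\<bar> \<partial>\<mu>) / measure \<mu> (ball c r))
           \<le> ennreal (C * diameter (ball c r)) *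
              enn_powr ((\<integral>\<^sup>+x\<in>ball c (\<sigma> * r). enn_powr (g x) Q \<partial>\<mu>) / emeasure \<mu> (ball c (\<sigma> * r)))
                       (1 / Q)"
    using assms(3,4) unfolding local_poincare_def by meson
  obtain c0 R0 where c0: "0 < c0" "0 < R0"
    "\<And>x r. x \<in> K \<Longrightarrow> 0 < r \<Longrightarrow> r < R0 \<Longrightarrow> c0 * r powr Q \<le> measure \<mu> (ball x r)"
    using homogeneous_lower_bound[OF mm assms(2,4)] by metis
  \<comment> \<open>The factor 2 comes from the diameter, \<open>2 powr (1/Q)\<close> from the two
    terms of the threshold bound, and the last factor from the lower mass bound.\<close>
  define C' where "C' = C * 2 * 2 powr (1/Q) * (1/c0) powr (1/p)"
  show ?thesis
  proof (rule that[of C' \<sigma> "min R R0"])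
    show "0 < C'" using P(1) c0(1) by (simp add: C'_def)
    show "1 \<le> \<sigma>" "0 < min R R0" using P c0 by auto
    fix u :: "'a \<Rightarrow> real" and g c r I
    assume u: "continuous_on UNIV u" "upper_gradient u g" and c: "c \<in> K"
      and r: "0 < r" "r < min R R0" and I: "0 < I"
      and gI: "(\<integral>\<^sup>+x\<in>ball c (\<sigma> * r). enn_powr (g x) p \<partial>\<mu>) \<le> ennreal I"
    let ?osc = "(\<integral>x\<in>ball c r. \<bar>u x - ball_average \<mu> u (ball c r)\<bar> \<partial>\<mu>) / measure \<mu> (ball c r)"
    let ?B = "ball c (\<sigma> * r)"
    define m where "m = measure \<mu> ?B"
    \<comment> \<open>An upper bound for the mean of the \<open>p\<close>-th power of
      \<open>g\<close> over \<open>?B\<close>; with this threshold both terms of the integrated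
      bound are at most \<open>A powr (Q/p) * m\<close>.\<close>
    define A where "A = I / (c0 * r powr Q)"
    have gm: "g \<in> borel_measurable \<mu>"
      using u(2) measurable_cong_sets[OF metric_measure_sets[OF mm] refl]
      unfolding upper_gradient_def by blast
    note [measurable] = borel_measurable_enn_powr[OF gm]
    have [measurable]: "?B \<in> sets \<mu>" by (simp add: metric_measure_sets[OF mm])
    have "0 < A" using I c0(1) r by (simp add: A_def)
    \<comment> \<open>The mass bound is taken at radius \<open>r\<close> and passed on by inclusion,
      as \<open>\<sigma> * r\<close> may exceed \<open>R0\<close>.\<close>
    have "r \<le> \<sigma> * r" using P(2) r by simp
    then have "measure \<mu> (ball c r) \<le> m"
      unfolding m_def by (intro metric_measure_ball_mono[OF mm] subset_ball)
    then have m: "c0 * r powr Q \<le> m" using c0(3)[of c r] c r by simp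
    have "0 < c0 * r powr Q" using c0 r by simp
    then have "0 < m" using m by simp
    have "I = A * (c0 * r powr Q)" using c0(1) r(1) by (simp add: A_def)
    also have "\<dots> \<le> A * m" using m \<open>0 < A\<close> by simp
    finally have IA: "I \<le> A * m" .
    have "(\<integral>\<^sup>+x\<in>?B. enn_powr (g x) Q \<partial>\<mu>)
        \<le> (\<integral>\<^sup>+x. ennreal (A powr (Q/p)) * indicator ?B x
              + ennreal (A powr (Q/p - 1)) * (enn_powr (g x) p * indicator ?B x) \<partial>\<mu>)"
    proof (rule nn_integral_mono)
      fix x
      show "enn_powr (g x) Q * indicator ?B x \<le> ennreal (A powr (Q/p)) * indicator ?B x
              + ennreal (A powr (Q/p - 1)) * (enn_powr (g x) p * indicator ?B x)"
        using enn_powr_le_threshold[of A Q p "g x"] \<open>0 < A\<close> assms(5,6)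
        by (auto simp: indicator_def)
    qed
    also have "\<dots> = ennreal (A powr (Q/p)) * ennreal m
        + ennreal (A powr (Q/p - 1)) * (\<integral>\<^sup>+x\<in>?B. enn_powr (g x) p \<partial>\<mu>)"
      by (simp add: nn_integral_add nn_integral_cmult nn_integral_cmult_indicator m_def emeasure_eq_measure)
    also have "\<dots> \<le> ennreal (A powr (Q/p)) * ennreal m + ennreal (A powr (Q/p - 1)) * ennreal (A * m)"
      using IA by (intro add_left_mono mult_left_mono order_trans[OF gI] ennreal_leI) auto
    also have "\<dots> = ennreal (2 * A powr (Q/p) * m)"
      using \<open>0 < A\<close> \<open>0 < m\<close>
      by (simp add: ennreal_mult[symmetric] ennreal_plus[symmetric] powr_diff del: ennreal_plus)
    finally have gQ: "(\<integral>\<^sup>+x\<in>?B. enn_powr (g x) Q \<partial>\<mu>) \<le> ennreal (2 * A powr (Q/p) * m)" .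
    have "(\<integral>\<^sup>+x\<in>?B. enn_powr (g x) Q \<partial>\<mu>) / emeasure \<mu> ?B
        \<le> ennreal (2 * A powr (Q/p) * m) / ennreal m"
      using gQ by (simp add: m_def emeasure_eq_measure divide_right_mono_ennreal)
    also have "\<dots> = ennreal (2 * A powr (Q/p))"
      using \<open>0 < m\<close> \<open>0 < A\<close> by (subst divide_ennreal) auto
    finally have "enn_powr ((\<integral>\<^sup>+x\<in>?B. enn_powr (g x) Q \<partial>\<mu>) / emeasure \<mu> ?B) (1/Q)
        \<le> ennreal ((2 * A powr (Q/p)) powr (1/Q))"
      using assms(5) by (intro enn_powr_mono_ennreal) auto
    also have "(2 * A powr (Q/p)) powr (1/Q) = 2 powr (1/Q) * A powr (1/p)"
      using \<open>0 < A\<close> assms(5) by (simp add: powr_mult powr_powr)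
    finally have avg: "enn_powr ((\<integral>\<^sup>+x\<in>?B. enn_powr (g x) Q \<partial>\<mu>) / emeasure \<mu> ?B) (1/Q)
        \<le> ennreal (2 powr (1/Q) * A powr (1/p))" .
    have "ennreal ?osc \<le> ennreal (C * diameter (ball c r)) *
        enn_powr ((\<integral>\<^sup>+x\<in>?B. enn_powr (g x) Q \<partial>\<mu>) / emeasure \<mu> ?B) (1/Q)"
      using poincare[OF u c r(1)] r by simp
    also have "\<dots> \<le> ennreal (C * (2 * r)) * ennreal (2 powr (1/Q) * A powr (1/p))"
      using P(1) diameter_ball_le[of r c] r avg
      by (intro mult_mono ennreal_leI mult_left_mono) auto
    also have "\<dots> = ennreal (C * (2 * r) * (2 powr (1/Q) * A powr (1/p)))"
      using P(1) r by (intro ennreal_mult[symmetric]) auto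
    finally have "?osc \<le> C * (2 * r) * (2 powr (1/Q) * A powr (1/p))"
      using P(1) r by (subst (asm) ennreal_le_iff) auto
    also have "A powr (1/p) = I powr (1/p) * (1/c0) powr (1/p) * r powr (- (Q/p))"
      unfolding A_def using c0 r I
      by (simp add: powr_divide powr_mult powr_powr powr_minus field_simps)
    also have "C * (2 * r) * (2 powr (1/Q) * (I powr (1/p) * (1/c0) powr (1/p) * r powr (- (Q/p))))
        = C' * (r * r powr (- (Q/p))) * I powr (1/p)"
      by (simp add: C'_def)
    also have "r * r powr (- (Q/p)) = r powr (1 - Q/p)"
      using r by (simp add: powr_diff powr_minus field_simps)
    finally show "?osc \<le> C' * r powr (1 - Q/p) * I powr (1/p)" .
  qed
qed


section \<open>The Morrey estimate\<close>

lemma upper_gradient_dist: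
  assumes "upper_gradient f g"
  shows "upper_gradient (\<lambda>x. dist (f x) a) g"
  unfolding upper_gradient_def
proof (intro conjI allI impI)
  show "g \<in> borel_measurable borel" using assms unfolding upper_gradient_def by blast
  fix \<gamma> :: "real \<Rightarrow> 'a" assume "rectifiable_curve \<gamma>"
  then have "ennreal (dist (f (\<gamma> 0)) (f (\<gamma> 1))) \<le> line_integral g \<gamma>"
    using assms unfolding upper_gradient_def by blast
  moreover have "dist (dist (f (\<gamma> 0)) a) (dist (f (\<gamma> 1)) a) \<le> dist (f (\<gamma> 0)) (f (\<gamma> 1))"
    using abs_dist_diff_le[of "f (\<gamma> 0)" a "f (\<gamma> 1)"] by (simp add: dist_real_def dist_commute)
  ultimately show "ennreal (dist (dist (f (\<gamma> 0)) a) (dist (f (\<gamma> 1)) a)) \<le> line_integral g \<gamma>"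
    using ennreal_leI order_trans by blast
qed

text \<open>Continuity makes every point a Lebesgue point: once the ball is so small that
  \<open>u\<close> stays within \<open>e/2\<close> of \<open>u x\<close>, so does its
  average.\<close>

lemma ball_average_tendsto:
  fixes u :: "'a::metric_space \<Rightarrow> real"
  assumes "proper_space TYPE('a)" "metric_measure \<mu>" "continuous_on UNIV u"
    and "\<rho> \<longlonglongrightarrow> 0" "\<And>k. 0 < \<rho> k"
  shows "(\<lambda>k. ball_average \<mu> u (ball x (\<rho> k))) \<longlonglongrightarrow> u x"
proof (rule LIMSEQ_I)
  fix e :: real assume "0 < e"
  interpret finite_measure \<mu> by (rule metric_measure_finite[OF assms(2)])
  obtain d where d: "0 < d" "\<And>y. dist y x < d \<Longrightarrow> dist (u y) (u x) < e/2"
    using assms(3) \<open>0 < e\<close> unfolding continuous_on_iff by (metis UNIV_I half_gt_zero)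
  obtain N where N: "\<And>k. k \<ge> N \<Longrightarrow> \<rho> k < d"
    using order_tendstoD(2)[OF assms(4) d(1)] unfolding eventually_sequentially by blast
  have "norm (ball_average \<mu> u (ball x (\<rho> k)) - u x) < e" if "k \<ge> N" for k
  proof -
    let ?B = "ball x (\<rho> k)"
    have B: "?B \<in> sets \<mu>" by (simp add: metric_measure_sets[OF assms(2)])
    have pos: "0 < measure \<mu> ?B" by (rule metric_measure_ball_pos[OF assms(2,5)])
    have c: "set_integrable \<mu> ?B (\<lambda>y. a)" for a :: real
      unfolding set_integrable_def using B
      by (intro integrable_scaleR_left integrable_real_indicator) (auto simp: less_top[symmetric])
    have i: "set_integrable \<mu> ?B u" by (rule set_integrable_continuous_ball[OF assms(1-3)])
    have "\<bar>ball_average \<mu> u ?B - u x\<bar> \<le> (\<integral>y\<in>?B. \<bar>u y - u x\<bar> \<partial>\<mu>) / measure \<mu> ?B"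
      by (rule ball_average_diff_le[OF finite_measure_axioms B i pos])
    also have "\<dots> \<le> (\<integral>y\<in>?B. e/2 \<partial>\<mu>) / measure \<mu> ?B"
    proof (intro divide_right_mono set_integral_mono c set_integrable_abs set_integral_diff(1) i)
      fix y assume "y \<in> ?B"
      then show "\<bar>u y - u x\<bar> \<le> e/2"
        using d(2)[of y] N[OF that] by (simp add: dist_real_def dist_commute)
    qed simp
    also have "\<dots> = e/2" using pos B by (simp add: set_lebesgue_integral_def)
    finally show ?thesis using \<open>0 < e\<close> by simp
  qed
  then show "\<exists>N. \<forall>k\<ge>N. norm (ball_average \<mu> u (ball x (\<rho> k)) - u x) < e" by blast
qed

text \<open>By properness a bounded set lies in a compact ball with room to spare. Local constants
  taken on \<open>K'\<close> then also serve balls centred near \<open>K\<close>.\<close>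

lemma compact_neighbourhood:
  fixes K :: "'a::metric_space set"
  assumes "proper_space TYPE('a)" "compact K"
  obtains K' where "compact K'" "\<And>x y. x \<in> K \<Longrightarrow> dist x y \<le> 1 \<Longrightarrow> y \<in> K'"
proof -
  obtain a e where e: "\<And>y. y \<in> K \<Longrightarrow> dist a y \<le> e"
    using compact_imp_bounded[OF assms(2)] unfolding bounded_def by blast
  show ?thesis
  proof (rule that[of "cball a (e + 1)"])
    show "compact (cball a (e + 1))" using assms(1) unfolding proper_space_def by blast
    fix x y assume "x \<in> K" "dist x y \<le> 1"
    then show "y \<in> cball a (e + 1)"
      using e[of x] dist_triangle[of a y x] by simp
  qed
qed

lemma morrey_estimate:
  fixes \<mu> :: "'a::metric_space measure" and f :: "'a \<Rightarrow> 'b::metric_space"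
  assumes proper: "proper_space TYPE('a)" and mm: "metric_measure \<mu>"
    and hom: "locally_homogeneous \<mu> Q" and poin: "local_poincare \<mu> Q"
    and K: "compact K" and Q: "1 \<le> Q" "Q < p"
    and f: "continuous_on UNIV f" "upper_gradient f g"
  obtains C \<Lambda> R where "0 < C" "1 \<le> \<Lambda>" "0 < R"
    "\<And>z r I x y. z \<in> K \<Longrightarrow> 0 < r \<Longrightarrow> r < R \<Longrightarrow> 0 < I \<Longrightarrow>
      (\<integral>\<^sup>+x\<in>ball z (\<Lambda> * r). enn_powr (g x) p \<partial>\<mu>) \<le> ennreal I \<Longrightarrow> x \<in> ball z r \<Longrightarrow> y \<in> ball z r \<Longrightarrow>
      dist (f x) (f y) \<le> C * r powr (1 - Q/p) * I powr (1/p)"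
proof -
  interpret finite_measure \<mu> by (rule metric_measure_finite[OF mm])
  obtain K' where K': "compact K'" "\<And>x y. x \<in> K \<Longrightarrow> dist x y \<le> 1 \<Longrightarrow> y \<in> K'"
    using compact_neighbourhood[OF proper K] by metis
  obtain R1 C1 where hom': "0 < R1" "1 \<le> C1"
    "\<And>x r t. x \<in> K' \<Longrightarrow> 0 < r \<Longrightarrow> r \<le> t \<Longrightarrow> t < R1 \<Longrightarrow>
      measure \<mu> (ball x t) \<le> C1 * (t / r) powr Q * measure \<mu> (ball x r)"
    using homogeneousE[OF hom K'(1)] by metis
  obtain C2 \<sigma> R2 where poin': "0 < C2" "1 \<le> \<sigma>" "0 < R2"
    "\<And>(u :: 'a \<Rightarrow> real) g c r I. continuous_on UNIV u \<Longrightarrow> upper_gradient u g \<Longrightarrow> c \<in> K' \<Longrightarrow>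
      0 < r \<Longrightarrow> r < R2 \<Longrightarrow> 0 < I \<Longrightarrow> (\<integral>\<^sup>+x\<in>ball c (\<sigma> * r). enn_powr (g x) p \<partial>\<mu>) \<le> ennreal I \<Longrightarrow>
      (\<integral>x\<in>ball c r. \<bar>u x - ball_average \<mu> u (ball c r)\<bar> \<partial>\<mu>) / measure \<mu> (ball c r)
        \<le> C2 * r powr (1 - Q/p) * I powr (1/p)"
    using that by (rule poincare_Lp[OF mm hom poin K'(1) Q]) assumption+
  \<comment> \<open>Positive because \<open>p > Q\<close>; \<open>q\<close> is the factor by which
    the oscillation bound shrinks when the radius is halved.\<close>
  define \<gamma> where "\<gamma> = 1 - Q/p"
  define q :: real where "q = (1/2) powr \<gamma>"
  \<comment> \<open>Covers both comparisons of masses: the first step passes from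
    \<open>ball z (2 * r)\<close> to \<open>ball x r\<close> through \<open>ball x (4 * r)\<close>,
    while each later halving costs only \<open>2 powr Q\<close>.\<close>
  define D where "D = C1 * 4 powr Q"
  have "0 < \<gamma>" using Q by (simp add: \<gamma>_def)
  then have q: "0 < q" "q < 1" by (simp_all add: q_def powr_divide)
  have "0 < D" using hom'(2) by (simp add: D_def)
  \<comment> \<open>The three bounds keep the centres in \<open>K'\<close>, the radius
    \<open>4 * r\<close> below \<open>R1\<close> and the radius \<open>2 * r\<close> below
    \<open>R2\<close>.\<close>
  define R where "R = min 1 (min (R1/4) (R2/2))"
  define C where "C = 2 * (D * C2 * 2 powr \<gamma> / (1 - q))"
  have dev: "\<bar>u x - ball_average \<mu> u (ball z (2*r))\<bar>
      \<le> D * C2 * (2*r) powr \<gamma> * I powr (1/p) / (1 - q)"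
    if u: "continuous_on UNIV u" "upper_gradient u g" and z: "z \<in> K" and r: "0 < r" "r < R"
      and I: "0 < I" "(\<integral>\<^sup>+x\<in>ball z ((2*\<sigma> + 1) * r). enn_powr (g x) p \<partial>\<mu>) \<le> ennreal I"
      and x: "x \<in> ball z r" for u :: "'a \<Rightarrow> real" and z r I x
  proof -
    \<comment> \<open>Only the first ball is centred at \<open>z\<close>: all points of
      \<open>ball z r\<close> share its average, through which two of them are compared. The factor
      2 in \<open>C\<close> comes from using this twice.\<close>
    define c where "c k = (if k = 0 then z else x)" for k :: nat
    define \<rho> where "\<rho> k = 2 * r * (1/2) ^ k" for k :: nat
    let ?B = "\<lambda>k. ball (c k) (\<rho> k)"
    let ?v = "\<lambda>k. ball_average \<mu> u (?B k)"
    have r': "r < 1" "4 * r < R1" "2 * r < R2" using r by (auto simp: R_def)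
    have zx: "dist z x < r" using x by simp
    have \<rho>: "0 < \<rho> k" "\<rho> k \<le> 2 * r" "\<rho> (Suc k) = \<rho> k / 2" for k
      using r by (auto simp: \<rho>_def power_le_one)
    have cK: "c k \<in> K'" for k
      using K'(2)[OF z, of "c k"] zx r' by (simp add: c_def)
    have BS: "?B k \<in> sets \<mu>" for k by (simp add: metric_measure_sets[OF mm])
    have osc: "(\<integral>x\<in>?B k. \<bar>u x - ?v k\<bar> \<partial>\<mu>) / measure \<mu> (?B k)
        \<le> C2 * \<rho> k powr \<gamma> * I powr (1/p)" for k
      unfolding \<gamma>_def
    proof (rule poin'(4)[OF u cK \<rho>(1) _ I(1)])
      show "\<rho> k < R2" using \<rho>(2)[of k] r' by simp
      \<comment> \<open>The dilation \<open>2*\<sigma> + 1\<close> allows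
        \<open>2 * \<sigma> * r\<close> for the radius and \<open>r\<close> for the displacement of
        the centre.\<close>
      have "ball (c k) (\<sigma> * \<rho> k) \<subseteq> ball z ((2*\<sigma> + 1) * r)"
      proof
        fix y assume y: "y \<in> ball (c k) (\<sigma> * \<rho> k)"
        have "\<sigma> * \<rho> k \<le> \<sigma> * (2 * r)" using \<rho>(2) poin'(2) by (intro mult_left_mono) auto
        then show "y \<in> ball z ((2*\<sigma> + 1) * r)"
          using y zx r dist_triangle[of z y x]
          by (auto simp: c_def algebra_simps split: if_splits)
      qed
      then have "(\<integral>\<^sup>+x\<in>ball (c k) (\<sigma> * \<rho> k). enn_powr (g x) p \<partial>\<mu>)
          \<le> (\<integral>\<^sup>+x\<in>ball z ((2*\<sigma> + 1) * r). enn_powr (g x) p \<partial>\<mu>)"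
        by (intro nn_integral_mono) (auto simp: indicator_def)
      then show "(\<integral>\<^sup>+x\<in>ball (c k) (\<sigma> * \<rho> k). enn_powr (g x) p \<partial>\<mu>) \<le> ennreal I"
        using I(2) by (rule order_trans)
    qed
    have nested: "?B (Suc k) \<subseteq> ?B k \<and> measure \<mu> (?B k) \<le> D * measure \<mu> (?B (Suc k))" for k
    proof (cases "k = 0")
      case True
      have "y \<in> ball z (2 * r)" if "y \<in> ball x r" for y
        using that zx dist_triangle[of z y x] by simp
      moreover have "y \<in> ball x (4 * r)" if "y \<in> ball z (2 * r)" for y
        using that zx r dist_triangle[of x y z] by (simp add: dist_commute)
      ultimately have "ball x r \<subseteq> ball z (2 * r)" "ball z (2 * r) \<subseteq> ball x (4 * r)" by blast+
      moreover have "measure \<mu> (ball x (4 * r)) \<le> C1 * (4 * r / r) powr Q * measure \<mu> (ball x r)"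
        using cK[of 1] r r' by (intro hom'(3)) (auto simp: c_def)
      ultimately show ?thesis
        using metric_measure_ball_mono[OF mm, of z "2 * r" x "4 * r"] r True
        by (simp add: c_def \<rho>_def D_def)
    next
      case False
      have "measure \<mu> (ball x (\<rho> k)) \<le> C1 * (\<rho> k / \<rho> (Suc k)) powr Q * measure \<mu> (ball x (\<rho> (Suc k)))"
        using cK[of 1] \<rho>(1)[of k] \<rho>(2)[of k] r r'
        by (intro hom'(3)) (auto simp: c_def \<rho>(3))
      also have "\<rho> k / \<rho> (Suc k) = 2" using \<rho>(1)[of k] by (simp add: \<rho>(3))
      also have "C1 * 2 powr Q * measure \<mu> (ball x (\<rho> (Suc k))) \<le> D * measure \<mu> (ball x (\<rho> (Suc k)))"
        unfolding D_def using hom'(2) Q by (intro mult_right_mono mult_left_mono powr_mono2) auto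
      finally show ?thesis
        using False \<rho>(1)[of k] by (auto simp: c_def \<rho>(3) intro!: subset_ball)
    qed
    have step: "\<bar>?v (Suc k) - ?v k\<bar> \<le> (D * C2 * (2*r) powr \<gamma> * I powr (1/p)) * q ^ k" for k
    proof -
      have "\<bar>?v (Suc k) - ?v k\<bar> \<le> D * ((\<integral>x\<in>?B k. \<bar>u x - ?v k\<bar> \<partial>\<mu>) / measure \<mu> (?B k))"
        using nested[of k] metric_measure_ball_pos[OF mm \<rho>(1)]
        by (intro ball_average_chain finite_measure_axioms BS
            set_integrable_continuous_ball[OF proper mm u(1)]) auto
      also have "\<dots> \<le> D * (C2 * \<rho> k powr \<gamma> * I powr (1/p))"
        using osc \<open>0 < D\<close> by (intro mult_left_mono) auto
      also have "\<rho> k powr \<gamma> = (2*r) powr \<gamma> * q ^ k"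
      proof -
        have "((1/2::real) ^ k) powr \<gamma> = q ^ k"
          unfolding q_def by (simp add: powr_realpow[symmetric] powr_powr mult.commute)
        then show ?thesis using r by (simp add: \<rho>_def powr_mult)
      qed
      finally show ?thesis by (simp add: mult_ac)
    qed
    \<comment> \<open>The index is shifted because the ball of index 0 is centred at
      \<open>z\<close>.\<close>
    have "(\<lambda>k. ball_average \<mu> u (ball x (\<rho> (Suc k)))) \<longlonglongrightarrow> u x"
    proof (rule ball_average_tendsto[OF proper mm u(1)])
      have "(\<lambda>k. 2 * r * (1/2) ^ Suc k) \<longlonglongrightarrow> 2 * r * 0"
        by (intro tendsto_mult tendsto_const LIMSEQ_Suc LIMSEQ_power_zero) simp
      then show "(\<lambda>k. \<rho> (Suc k)) \<longlonglongrightarrow> 0" by (simp add: \<rho>_def)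
    qed (rule \<rho>(1))
    then have "(\<lambda>k. ?v (Suc k)) \<longlonglongrightarrow> u x" by (simp add: c_def)
    then have "?v \<longlonglongrightarrow> u x" by (rule LIMSEQ_imp_Suc)
    then have "\<bar>u x - ?v 0\<bar> \<le> (D * C2 * (2*r) powr \<gamma> * I powr (1/p)) / (1 - q)"
      using step q \<open>0 < D\<close> poin'(1) by (intro geometric_telescope) auto
    then show ?thesis by (simp add: c_def \<rho>_def)
  qed
  show ?thesis
  proof (rule that[of C "2*\<sigma> + 1" R])
    show "0 < C" using \<open>0 < D\<close> poin'(1) q by (simp add: C_def)
    show "1 \<le> 2*\<sigma> + 1" "0 < R" using poin' hom' by (auto simp: R_def)
    fix z r I x y
    assume z: "z \<in> K" and r: "0 < r" "r < R"
      and I: "0 < I" "(\<integral>\<^sup>+x\<in>ball z ((2*\<sigma> + 1) * r). enn_powr (g x) p \<partial>\<mu>) \<le> ennreal I"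
      and xy: "x \<in> ball z r" "y \<in> ball z r"
    \<comment> \<open>The distance to a point of the target is 1-Lipschitz, so \<open>g\<close>
      remains an upper gradient and the Poincare inequality for real functions applies;
      \<open>?u y = 0\<close> recovers the distance of the images.\<close>
    let ?u = "\<lambda>w. dist (f w) (f y)"
    have u: "continuous_on UNIV ?u" "upper_gradient ?u g"
      using f by (auto intro!: continuous_intros upper_gradient_dist)
    have "dist (f x) (f y) = \<bar>?u x - ?u y\<bar>" by simp
    also have "\<dots> \<le> 2 * (D * C2 * (2*r) powr \<gamma> * I powr (1/p) / (1 - q))"
      using dev[OF u z r I xy(1)] dev[OF u z r I xy(2)] by linarith
    also have "\<dots> = C * r powr (1 - Q/p) * I powr (1/p)"
      using r by (simp add: C_def powr_mult \<gamma>_def)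
    finally show "dist (f x) (f y) \<le> C * r powr (1 - Q/p) * I powr (1/p)" .
  qed
qed


section \<open>Counting separated points and the energy carried by fibres\<close>

lemma powr_small:
  fixes C e \<gamma> :: real
  assumes "0 < \<gamma>" "0 < e"
  obtains r0 where "0 < r0" "\<And>r. 0 < r \<Longrightarrow> r < r0 \<Longrightarrow> C * r powr \<gamma> \<le> e"
proof (rule that[of "(e / (\<bar>C\<bar> + 1)) powr (1/\<gamma>)"])
  have pos: "0 < e / (\<bar>C\<bar> + 1)" using assms by simp
  then show "0 < (e / (\<bar>C\<bar> + 1)) powr (1/\<gamma>)" by (metis less_irrefl powr_gt_zero)
  fix r :: real assume r: "0 < r" "r < (e / (\<bar>C\<bar> + 1)) powr (1/\<gamma>)"
  have "r powr \<gamma> \<le> ((e / (\<bar>C\<bar> + 1)) powr (1/\<gamma>)) powr \<gamma>"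
    using r assms by (intro powr_mono2) auto
  also have "\<dots> = e / (\<bar>C\<bar> + 1)" using pos assms by (simp add: powr_powr)
  finally have "r powr \<gamma> \<le> e / (\<bar>C\<bar> + 1)" .
  then have "(\<bar>C\<bar> + 1) * r powr \<gamma> \<le> e" by (simp add: field_simps)
  moreover have "C * r powr \<gamma> \<le> (\<bar>C\<bar> + 1) * r powr \<gamma>" by (intro mult_right_mono) auto
  ultimately show "C * r powr \<gamma> \<le> e" by linarith
qed

text \<open>A maximal \<open>L * r\<close>-separated set yields a cover by at most
  \<open>B * r powr (- b)\<close> balls of diameter at most \<open>2 * (L * r)\<close>. Its cost is
  of order \<open>r powr (t - b)\<close>, which tends to 0 with \<open>r\<close>.\<close>

lemma hausdorff_null_of_separated_bound:
  fixes E :: "'a::metric_space set"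
  assumes "0 < L" "0 < r0" "b < t" "0 < t"
    and bnd: "\<And>r S. 0 < r \<Longrightarrow> r < r0 \<Longrightarrow> finite S \<Longrightarrow> S \<subseteq> E \<Longrightarrow> separated (L * r) S \<Longrightarrow>
      real (card S) \<le> B * r powr (- b)"
  shows "hausdorff_measure t E = 0"
  unfolding hausdorff_measure_eq_0_iff
proof (intro allI impI)
  fix \<delta> :: real assume "0 < \<delta>"
  have le: "hausdorff_pre t \<delta> E \<le> ennreal e" if "0 < e" for e
  proof -
    obtain r1 where r1: "0 < r1" "\<And>r. 0 < r \<Longrightarrow> r < r1 \<Longrightarrow> (B * (2 * L) powr t) * r powr (t - b) \<le> e"
      using powr_small[of "t - b" e "B * (2 * L) powr t"] assms(3) \<open>0 < e\<close> by (metis diff_gt_0_iff_gt)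
    define r where "r = min (\<delta> / (2 * L)) (min (r0/2) (r1/2))"
    have "r \<le> \<delta> / (2 * L)" unfolding r_def by simp
    then have "2 * (L * r) \<le> \<delta>" using assms(1) by (simp add: field_simps)
    moreover have "0 < r" "r < r0" "r < r1"
      using \<open>0 < \<delta>\<close> assms(1,2) r1(1) by (auto simp: r_def)
    ultimately have r: "0 < r" "r < r0" "r < r1" "2 * (L * r) \<le> \<delta>" by auto
    have Lr: "0 < L * r" using assms(1) r by simp
    have "\<exists>Z. finite Z \<and> Z \<subseteq> E \<and> separated (L * r) Z \<and> E \<subseteq> (\<Union>z\<in>Z. ball z (L * r))"
      by (rule maximal_separated_net[OF Lr]) (rule bnd[OF r(1,2)])
    then obtain Z where Z: "finite Z" "Z \<subseteq> E" "separated (L * r) Z"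
      "E \<subseteq> (\<Union>z\<in>Z. ball z (L * r))" by blast
    have d: "diameter (ball z (L * r)) \<le> 2 * (L * r)" for z :: 'a
      using Lr by (intro diameter_ball_le) simp
    have "hausdorff_pre t \<delta> E \<le> (\<Sum>z\<in>Z. ennreal (hd_term t (ball z (L * r))))"
    proof (rule hausdorff_pre_le_finite_cover[OF Z(1,4)])
      show "diameter (ball z (L * r)) \<le> \<delta>" for z :: 'a using d[of z] r(4) by simp
    qed (use \<open>0 < \<delta>\<close> in auto)
    also have "\<dots> \<le> (\<Sum>z\<in>Z. ennreal ((2 * (L * r)) powr t))"
      using d assms(4) by (intro sum_mono ennreal_leI hd_term_le) auto
    also have "\<dots> = ennreal (real (card Z) * (2 * (L * r)) powr t)"
      by (simp add: ennreal_mult ennreal_of_nat_eq_real_of_nat)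
    also have "\<dots> \<le> ennreal e"
    proof (rule ennreal_leI)
      have "real (card Z) * (2 * (L * r)) powr t \<le> (B * r powr (- b)) * (2 * (L * r)) powr t"
        using bnd[OF r(1,2) Z(1-3)] by (intro mult_right_mono) auto
      also have "\<dots> = (B * (2 * L) powr t) * (r powr (- b) * r powr t)"
        using assms(1) r by (simp add: powr_mult)
      also have "\<dots> = (B * (2 * L) powr t) * r powr (t - b)"
        by (simp add: powr_add[symmetric])
      also have "\<dots> \<le> e" by (rule r1(2)[OF r(1,3)])
      finally show "real (card Z) * (2 * (L * r)) powr t \<le> e" .
    qed
    finally show ?thesis .
  qed
  have "hausdorff_pre t \<delta> E \<le> 0"
    by (rule ennreal_le_epsilon) (simp add: le)
  then show "hausdorff_pre t \<delta> E = 0" by simp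
qed

text \<open>After exchanging sum and integral, the integrand at \<open>x\<close> is
  \<open>h x\<close> times the number of balls containing \<open>x\<close>.\<close>

lemma sum_nn_integral_bounded_overlap:
  fixes h :: "'a::metric_space \<Rightarrow> ennreal" and M :: real
  assumes "sets \<mu> = sets borel" "h \<in> borel_measurable \<mu>" "finite Z"
    and sub: "\<And>z. z \<in> Z \<Longrightarrow> ball z \<rho> \<subseteq> K'" "K' \<in> sets \<mu>"
    and ov: "\<And>x. real (card {z\<in>Z. x \<in> ball z \<rho>}) \<le> M"
  shows "(\<Sum>z\<in>Z. \<integral>\<^sup>+x\<in>ball z \<rho>. h x \<partial>\<mu>) \<le> ennreal M * (\<integral>\<^sup>+x\<in>K'. h x \<partial>\<mu>)"
proof -
  note [measurable] = assms(2) sub(2)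
  have [measurable]: "ball z \<rho> \<in> sets \<mu>" for z by (simp add: assms(1))
  have "(\<Sum>z\<in>Z. \<integral>\<^sup>+x\<in>ball z \<rho>. h x \<partial>\<mu>) = (\<integral>\<^sup>+x. (\<Sum>z\<in>Z. h x * indicator (ball z \<rho>) x) \<partial>\<mu>)"
    by (rule nn_integral_sum[symmetric]) measurable
  also have "\<dots> \<le> (\<integral>\<^sup>+x. ennreal M * (h x * indicator K' x) \<partial>\<mu>)"
  proof (rule nn_integral_mono)
    fix x
    show "(\<Sum>z\<in>Z. h x * indicator (ball z \<rho>) x) \<le> ennreal M * (h x * indicator K' x)"
    proof (cases "x \<in> K'")
      case False
      then have "(\<Sum>z\<in>Z. h x * indicator (ball z \<rho>) x) = 0"
        using sub(1) by (intro sum.neutral ballI) (auto simp: indicator_def subset_iff)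
      then show ?thesis by simp
    next
      case True
      have "(\<Sum>z\<in>Z. h x * indicator (ball z \<rho>) x) = (\<Sum>z\<in>{z\<in>Z. x \<in> ball z \<rho>}. h x)"
        unfolding sum.inter_filter[OF assms(3)] by (rule sum.cong) (auto simp: indicator_def)
      also have "\<dots> = ennreal (real (card {z\<in>Z. x \<in> ball z \<rho>})) * h x"
        by (simp add: ennreal_of_nat_eq_real_of_nat)
      also have "\<dots> \<le> ennreal M * h x"
        by (intro mult_right_mono ennreal_leI ov) simp
      finally show ?thesis using True by simp
    qed
  qed
  also have "\<dots> = ennreal M * (\<integral>\<^sup>+x\<in>K'. h x \<partial>\<mu>)"
    by (rule nn_integral_cmult) measurable
  finally show ?thesis .
qed

text \<open>The fibre over \<open>a\<close> lies over \<open>ball a r\<close>, so it is covered by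
  at most \<open>C * r powr (-s)\<close> balls of radius \<open>C * r\<close>; packing allows at
  most \<open>M\<close> points of \<open>S\<close> in each of them.\<close>

lemma DS_fibre_card_bound:
  fixes \<mu> :: "'x::metric_space measure" and \<pi> :: "'x \<Rightarrow> 'w::metric_space" and K :: "'x set"
  assumes "metric_measure \<mu>" "locally_homogeneous \<mu> Q" "locally_DS_regular \<pi> s" "compact K"
  obtains N r0 where "0 < N" "0 < r0"
    "\<And>a r S. 0 < r \<Longrightarrow> r < r0 \<Longrightarrow> finite S \<Longrightarrow> S \<subseteq> \<pi> -` {a} \<inter> K \<Longrightarrow> separated r S \<Longrightarrow>
      real (card S) \<le> N * r powr (- s)"
proof -
  obtain C rd where DS: "1 \<le> C" "0 < rd"
    "\<And>w r. 0 < r \<Longrightarrow> r < rd \<Longrightarrow> \<exists>F. finite F \<and> real (card F) \<le> C * r powr (-s) \<and>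
                \<pi> -` ball w r \<inter> K \<subseteq> (\<Union>c\<in>F. ball c (C * r))"
    using assms(3,4) unfolding locally_DS_regular_def by meson
  have "0 < C" using DS(1) by simp
  obtain M r1 where M: "0 < M" "0 < r1"
    "\<And>r x S. 0 < r \<Longrightarrow> r < r1 \<Longrightarrow> finite S \<Longrightarrow> S \<subseteq> K \<Longrightarrow> S \<subseteq> ball x (C * r) \<Longrightarrow> separated r S
      \<Longrightarrow> real (card S) \<le> M"
    using separated_card_bound[OF assms(1,2,4) \<open>0 < C\<close>] by metis
  show ?thesis
  proof (rule that[of "C * M" "min rd r1"])
    show "0 < C * M" "0 < min rd r1" using \<open>0 < C\<close> M DS by auto
    fix a r S assume r: "0 < r" "r < min rd r1"
      and S: "finite S" "S \<subseteq> \<pi> -` {a} \<inter> K" "separated r S"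
    obtain F where F: "finite F" "real (card F) \<le> C * r powr (-s)"
        "\<pi> -` ball a r \<inter> K \<subseteq> (\<Union>c\<in>F. ball c (C * r))"
      using DS(3)[of r a] r by auto
    have "S \<subseteq> \<pi> -` ball a r \<inter> K" using S(2) r(1) by auto
    then have "S = (\<Union>c\<in>F. S \<inter> ball c (C * r))" using F(3) by blast
    then have "card S \<le> (\<Sum>c\<in>F. card (S \<inter> ball c (C * r)))"
      using card_UN_le[OF F(1), of "\<lambda>c. S \<inter> ball c (C * r)"] by simp
    then have "real (card S) \<le> (\<Sum>c\<in>F. real (card (S \<inter> ball c (C * r))))"
      by (metis of_nat_le_iff of_nat_sum)
    also have "\<dots> \<le> (\<Sum>c\<in>F. M)"
      using r S by (intro sum_mono M(3)) (auto intro: separated_subset)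
    also have "\<dots> \<le> (C * r powr (-s)) * M"
      using F(2) M(1) by simp
    finally show "real (card S) \<le> C * M * r powr (- s)" by (simp add: mult_ac)
  qed
qed


text \<open>Hoelder's inequality with exponent \<open>a/p\<close> over at most
  \<open>N * r powr (- s)\<close> points, run by contradiction: a smaller total energy would push
  the sum in the last hypothesis down to at most \<open>\<eta>\<close>.\<close>

lemma fibre_energy_lower_bound:
  fixes I :: "'x \<Rightarrow> real"
  assumes "finite Z" "real (card Z) \<le> N * r powr (- s)" "\<And>z. z \<in> Z \<Longrightarrow> 0 < I z"
    and "0 < N" "0 < C" "0 < \<eta>" "0 < r" "0 < a" "a < p" "0 < p"
    and sum: "\<eta> < (\<Sum>z\<in>Z. (C * r powr (1 - Q/p) * I z powr (1/p)) powr a)"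
  shows "(\<eta> / (C powr a * (N + 1))) powr (p/a) * r powr ((Q - s) - p * (1 - s/a)) < (\<Sum>z\<in>Z. I z)"
proof (rule ccontr)
  define b where "b = (Q - s) - p * (1 - s/a)"
  \<comment> \<open>Chosen so that
    \<open>C powr a * (N + 1) * c powr \<theta> = \<eta>\<close>.\<close>
  define c where "c = (\<eta> / (C powr a * (N + 1))) powr (p/a)"
  \<comment> \<open>The share of each point when the energy \<open>c * r powr b\<close> is spread
    evenly over \<open>r powr (- s)\<close> points.\<close>
  define A where "A = c * r powr (b + s)"
  define \<theta> where "\<theta> = a/p"
  have \<theta>: "0 < \<theta>" "\<theta> < 1" using assms by (auto simp: \<theta>_def)
  have base: "0 < \<eta> / (C powr a * (N + 1))" using assms by simp
  have "0 < c" unfolding c_def using base by (metis less_irrefl powr_gt_zero)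
  then have "0 < A" using assms by (simp add: A_def)
  assume "\<not> ?thesis"
  then have S: "(\<Sum>z\<in>Z. I z) \<le> c * r powr b" unfolding c_def b_def by simp
  have AS: "A powr (\<theta> - 1) * (c * r powr b) = A powr \<theta> * r powr (- s)"
  proof -
    have "c * r powr b = A * r powr (- s)"
      using assms(7) by (simp add: A_def powr_add[symmetric] mult.assoc)
    then show ?thesis using \<open>0 < A\<close> by (simp add: powr_diff)
  qed
  have "(\<Sum>z\<in>Z. I z powr \<theta>) \<le> (\<Sum>z\<in>Z. A powr \<theta> + A powr (\<theta> - 1) * I z)"
    using assms(3) \<open>0 < A\<close> \<theta> by (intro sum_mono powr_le_threshold) (auto intro: less_imp_le)
  also have "\<dots> = real (card Z) * A powr \<theta> + A powr (\<theta> - 1) * (\<Sum>z\<in>Z. I z)"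
    by (simp add: sum.distrib sum_distrib_left)
  also have "\<dots> \<le> (N * r powr (- s)) * A powr \<theta> + A powr (\<theta> - 1) * (c * r powr b)"
    using S assms(2) by (intro add_mono mult_right_mono mult_left_mono) auto
  also have "\<dots> = (N + 1) * (r powr (- s) * A powr \<theta>)"
    unfolding AS by (simp add: algebra_simps)
  finally have le: "(\<Sum>z\<in>Z. I z powr \<theta>) \<le> (N + 1) * (r powr (- s) * A powr \<theta>)" .
  have A\<theta>: "A powr \<theta> = c powr \<theta> * r powr ((b + s) * \<theta>)"
    using \<open>0 < c\<close> assms(7) by (simp add: A_def powr_mult powr_powr)
  have c\<theta>: "c powr \<theta> = \<eta> / (C powr a * (N + 1))"
    using base assms by (simp add: c_def \<theta>_def powr_powr)
  \<comment> \<open>All powers of \<open>r\<close> cancel; this equation is what determines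
    \<open>b\<close>.\<close>
  have expo: "(1 - Q/p) * a + (- s + (b + s) * \<theta>) = 0"
    using assms(8,10) by (simp add: b_def \<theta>_def field_simps)
  have "(\<Sum>z\<in>Z. (C * r powr (1 - Q/p) * I z powr (1/p)) powr a)
      = (\<Sum>z\<in>Z. C powr a * r powr ((1 - Q/p) * a) * I z powr \<theta>)"
    using assms(3,5,7) by (intro sum.cong refl) (simp add: powr_mult powr_powr \<theta>_def)
  also have "\<dots> = C powr a * r powr ((1 - Q/p) * a) * (\<Sum>z\<in>Z. I z powr \<theta>)"
    by (simp add: sum_distrib_left)
  also have "\<dots> \<le> C powr a * r powr ((1 - Q/p) * a) * ((N + 1) * (r powr (- s) * A powr \<theta>))"
    using le by (intro mult_left_mono) auto
  also have "\<dots> = (C powr a * (N + 1) * c powr \<theta>) * r powr ((1 - Q/p) * a + (- s + (b + s) * \<theta>))"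
    unfolding A\<theta> powr_add by (simp add: mult_ac)
  also have "\<dots> = \<eta>"
    unfolding expo c\<theta> using assms by simp
  finally show False using sum by simp
qed

text \<open>Fixing both the scale \<open>\<delta>\<close> and the threshold \<open>\<eta>\<close>
  makes the energy lower bound uniform over the set, so that its separated subsets can be counted at
  every small scale.\<close>

lemma exceptional_set_null:
  fixes \<mu> :: "'x::metric_space measure" and \<pi> :: "'x \<Rightarrow> 'w::metric_space"
    and f :: "'x \<Rightarrow> 'y::metric_space" and K :: "'x set"
  assumes proper: "proper_space TYPE('x)" and mm: "metric_measure \<mu>"
    and hom: "locally_homogeneous \<mu> Q" and poin: "local_poincare \<mu> Q"
    and DS: "locally_DS_regular \<pi> s"
    and K: "compact K" and Q: "1 \<le> Q" "Q < p"
    and f: "continuous_on UNIV f" "upper_gradient f g" "Lp_loc \<mu> p g"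
    and a: "0 < a" "a < p" and "0 < \<delta>" "0 < \<eta>"
    and t: "0 < t" "(Q - s) - p * (1 - s/a) < t"
  shows "hausdorff_measure t {w. ennreal \<eta> < hausdorff_pre a \<delta> (f ` (\<pi> -` {w} \<inter> K))} = 0"
proof -
  interpret finite_measure \<mu> by (rule metric_measure_finite[OF mm])
  define E where "E = {w. ennreal \<eta> < hausdorff_pre a \<delta> (f ` (\<pi> -` {w} \<inter> K))}"
  define b where "b = (Q - s) - p * (1 - s/a)"
  obtain K' where K': "compact K'" "\<And>x y. x \<in> K \<Longrightarrow> dist x y \<le> 1 \<Longrightarrow> y \<in> K'"
    using compact_neighbourhood[OF proper K] by metis
  have K'S: "K' \<in> sets \<mu>"
    using compact_imp_closed[OF K'(1)] by (simp add: metric_measure_sets[OF mm])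
  obtain C \<Lambda> R where morrey: "0 < C" "1 \<le> \<Lambda>" "0 < R"
    "\<And>z r I x y. z \<in> K \<Longrightarrow> 0 < r \<Longrightarrow> r < R \<Longrightarrow> 0 < I \<Longrightarrow>
      (\<integral>\<^sup>+x\<in>ball z (\<Lambda> * r). enn_powr (g x) p \<partial>\<mu>) \<le> ennreal I \<Longrightarrow> x \<in> ball z r \<Longrightarrow> y \<in> ball z r \<Longrightarrow>
      dist (f x) (f y) \<le> C * r powr (1 - Q/p) * I powr (1/p)"
    using that by (rule morrey_estimate[OF proper mm hom poin K Q f(1,2)]) assumption+
  obtain N r1 where N: "0 < N" "0 < r1"
    "\<And>w r S. 0 < r \<Longrightarrow> r < r1 \<Longrightarrow> finite S \<Longrightarrow> S \<subseteq> \<pi> -` {w} \<inter> K \<Longrightarrow> separated r S \<Longrightarrow>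
      real (card S) \<le> N * r powr (- s)"
    using that by (rule DS_fibre_card_bound[OF mm hom DS K]) assumption+
  have "0 < \<Lambda>" using morrey(2) by simp
  obtain M r2 where M: "0 < M" "0 < r2"
    "\<And>r x S. 0 < r \<Longrightarrow> r < r2 \<Longrightarrow> finite S \<Longrightarrow> S \<subseteq> K \<Longrightarrow> S \<subseteq> ball x (\<Lambda> * r) \<Longrightarrow> separated r S
      \<Longrightarrow> real (card S) \<le> M"
    using that by (rule separated_card_bound[OF mm hom K \<open>0 < \<Lambda>\<close>]) assumption+
  obtain L0 where L0: "\<And>x y. x \<in> K \<Longrightarrow> y \<in> K \<Longrightarrow> dist (\<pi> x) (\<pi> y) \<le> L0 * dist x y"
    using DS K unfolding locally_DS_regular_def by meson
  \<comment> \<open>The Lipschitz constant supplied may be 0 or negative; the maximum makes it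
    positive.\<close>
  define L where "L = max L0 1"
  have "0 < L" by (simp add: L_def)
  have Lip: "dist (\<pi> x) (\<pi> y) \<le> L * dist x y" if "x \<in> K" "y \<in> K" for x y
    using L0[OF that] mult_right_mono[of L0 L "dist x y"] by (simp add: L_def)
  \<comment> \<open>The summand 1 makes all energies strictly positive.\<close>
  define h where "h x = enn_powr (g x) p + 1" for x
  have gm: "g \<in> borel_measurable \<mu>"
    using f(2) measurable_cong_sets[OF metric_measure_sets[OF mm] refl]
    unfolding upper_gradient_def by blast
  note [measurable] = borel_measurable_enn_powr[OF gm] K'S
  have hm [measurable]: "h \<in> borel_measurable \<mu>" unfolding h_def by measurable
  define J where "J = enn2real (\<integral>\<^sup>+x\<in>K'. h x \<partial>\<mu>)"
  have J: "(\<integral>\<^sup>+x\<in>K'. h x \<partial>\<mu>) = ennreal J"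
  proof -
    have "(\<integral>\<^sup>+x\<in>K'. h x \<partial>\<mu>) = (\<integral>\<^sup>+x\<in>K'. enn_powr (g x) p \<partial>\<mu>) + emeasure \<mu> K'"
      unfolding h_def by (simp add: distrib_right nn_integral_add)
    also have "\<dots> < \<infinity>"
      using f(3) K'(1) unfolding Lp_loc_def by (auto simp: less_top[symmetric])
    finally show ?thesis unfolding J_def by (simp add: less_top)
  qed
  have "0 \<le> J" by (simp add: J_def)
  \<comment> \<open>As \<open>J\<close> bounds the energy of every ball used, the Morrey bound on
    image diameters falls below \<open>\<delta>\<close> once \<open>r < r3\<close>.\<close>
  have "0 < 1 - Q/p" using Q by simp
  then obtain r3 where r3: "0 < r3"
    "\<And>r. 0 < r \<Longrightarrow> r < r3 \<Longrightarrow> (C * J powr (1/p)) * r powr (1 - Q/p) \<le> \<delta>"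
    using powr_small[of "1 - Q/p" \<delta> "C * J powr (1/p)"] \<open>0 < \<delta>\<close> by metis
  define c where "c = (\<eta> / (C powr a * (N + 1))) powr (p/a)"
  have "0 < \<eta> / (C powr a * (N + 1))" using \<open>0 < \<eta>\<close> morrey(1) N(1) by simp
  then have "0 < c" unfolding c_def by (metis less_irrefl powr_gt_zero)
  \<comment> \<open>The entry \<open>1/\<Lambda>\<close> gives \<open>\<Lambda> * r \<le> 1\<close>,
    which keeps the dilated balls inside \<open>K'\<close>.\<close>
  define r0 where "r0 = Min {R, r1, r2, r3, 1/\<Lambda>}"
  have "0 < r0" using morrey N M r3 \<open>0 < \<Lambda>\<close> by (simp add: r0_def)
  have count: "real (card A) \<le> (M * J / c) * r powr (- b)"
    if r: "0 < r" "r < r0" and A: "finite A" "A \<subseteq> E" "separated (L * r) A" for r A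
  proof -
    have r': "r < R" "r < r1" "r < r2" "r < r3" "\<Lambda> * r \<le> 1"
      using r \<open>0 < \<Lambda>\<close> by (auto simp: r0_def field_simps)
    define I where "I z = enn2real (\<integral>\<^sup>+x\<in>ball z (\<Lambda> * r). h x \<partial>\<mu>)" for z
    have BS [measurable]: "ball z t \<in> sets \<mu>" for z t by (simp add: metric_measure_sets[OF mm])
    have BK: "ball z (\<Lambda> * r) \<subseteq> K'" if "z \<in> K" for z
      using K'(2)[OF that] r'(5) by force
    have Ile: "(\<integral>\<^sup>+x\<in>ball z (\<Lambda> * r). h x \<partial>\<mu>) \<le> ennreal J" if "z \<in> K" for z
      unfolding J[symmetric] using BK[OF that] by (intro nn_integral_mono) (auto simp: indicator_def)
    have I: "ennreal (I z) = (\<integral>\<^sup>+x\<in>ball z (\<Lambda> * r). h x \<partial>\<mu>)" if "z \<in> K" for z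
      unfolding I_def using Ile[OF that] by (intro ennreal_enn2real) (auto simp: less_top[symmetric] top_unique)
    have IJ: "I z \<le> J" if "z \<in> K" for z
      using Ile[OF that] \<open>0 \<le> J\<close> unfolding I[OF that, symmetric] by (simp add: ennreal_le_iff)
    have Ipos: "0 < I z" if "z \<in> K" for z
    proof -
      have "0 < measure \<mu> (ball z (\<Lambda> * r))"
        using r \<open>0 < \<Lambda>\<close> by (intro metric_measure_ball_pos[OF mm]) simp
      then have "0 < (\<integral>\<^sup>+x. indicator (ball z (\<Lambda> * r)) x \<partial>\<mu>)"
        by (simp add: emeasure_eq_measure)
      also have "\<dots> \<le> (\<integral>\<^sup>+x\<in>ball z (\<Lambda> * r). h x \<partial>\<mu>)"
        by (intro nn_integral_mono) (auto simp: indicator_def h_def)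
      finally show ?thesis unfolding I[OF that, symmetric] by simp
    qed
    have gI: "(\<integral>\<^sup>+x\<in>ball z (\<Lambda> * r). enn_powr (g x) p \<partial>\<mu>) \<le> ennreal (I z)" if "z \<in> K" for z
      unfolding I[OF that] by (intro nn_integral_mono) (auto simp: indicator_def h_def)
    have "\<exists>Z. finite Z \<and> Z \<subseteq> \<pi> -` {w} \<inter> K \<and> separated r Z \<and> \<pi> -` {w} \<inter> K \<subseteq> (\<Union>z\<in>Z. ball z r)" for w
      by (rule maximal_separated_net[OF r(1)]) (rule N(3)[OF r(1) r'(2)])
    then obtain Z where Z: "\<And>w. finite (Z w)" "\<And>w. Z w \<subseteq> \<pi> -` {w} \<inter> K" "\<And>w. separated r (Z w)"
      "\<And>w. \<pi> -` {w} \<inter> K \<subseteq> (\<Union>z\<in>Z w. ball z r)" by metis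
    have energy: "c * r powr b \<le> (\<Sum>z\<in>Z w. I z)" if "w \<in> E" for w
    proof -
      define d where "d z = C * r powr (1 - Q/p) * I z powr (1/p)" for z
      have d0: "0 \<le> d z" for z using morrey(1) by (simp add: d_def)
      have dist: "dist (f x) (f y) \<le> d z" if "z \<in> Z w" "x \<in> ball z r" "y \<in> ball z r" for x y z
      proof -
        have "z \<in> K" using that Z(2) by blast
        then show ?thesis
          unfolding d_def by (intro morrey(4)[OF _ r(1) r'(1) Ipos gI that(2,3)])
      qed
      have diam: "bounded (f ` ball z r)" "diameter (f ` ball z r) \<le> d z" if "z \<in> Z w" for z
      proof -
        show "diameter (f ` ball z r) \<le> d z"
          using dist[OF that] d0[of z] by (intro diameter_le_dist) auto
        show "bounded (f ` ball z r)"
          unfolding bounded_two_points using dist[OF that] by (intro exI[of _ "d z"]) auto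
      qed
      have d\<delta>: "d z \<le> \<delta>" if "z \<in> Z w" for z
      proof -
        have "z \<in> K" using that Z(2) by blast
        then have "I z powr (1/p) \<le> J powr (1/p)"
          using IJ Ipos Q by (intro powr_mono2) (auto intro: less_imp_le)
        then have "d z \<le> C * r powr (1 - Q/p) * J powr (1/p)"
          unfolding d_def using morrey(1) by (intro mult_left_mono) auto
        also have "\<dots> \<le> \<delta>" using r3(2)[OF r(1) r'(4)] by (simp add: mult_ac)
        finally show ?thesis .
      qed
      \<comment> \<open>The images of the balls around the net points compete in the content at
        scale \<open>\<delta>\<close>.\<close>
      have "ennreal \<eta> < hausdorff_pre a \<delta> (f ` (\<pi> -` {w} \<inter> K))" using \<open>w \<in> E\<close> by (simp add: E_def)
      also have "\<dots> \<le> (\<Sum>z\<in>Z w. ennreal (hd_term a (f ` ball z r)))"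
      proof (rule hausdorff_pre_le_finite_cover[OF Z(1)])
        show "f ` (\<pi> -` {w} \<inter> K) \<subseteq> (\<Union>z\<in>Z w. f ` ball z r)" using Z(4)[of w] by blast
        show "diameter (f ` ball z r) \<le> \<delta>" if "z \<in> Z w" for z
          using diam(2)[OF that] d\<delta>[OF that] by simp
      qed (use \<open>0 < \<delta>\<close> diam(1) in auto)
      also have "\<dots> \<le> (\<Sum>z\<in>Z w. ennreal (d z powr a))"
        using diam a by (intro sum_mono ennreal_leI hd_term_le) auto
      also have "\<dots> = ennreal (\<Sum>z\<in>Z w. d z powr a)" by (simp add: sum_ennreal)
      finally have "\<eta> < (\<Sum>z\<in>Z w. d z powr a)"
        using \<open>0 < \<eta>\<close> by (simp add: ennreal_less_iff)
      moreover have "0 < I z" if "z \<in> Z w" for z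
        using that Z(2) Ipos by blast
      ultimately have "c * r powr b < (\<Sum>z\<in>Z w. I z)"
        unfolding c_def b_def d_def
        using N(3)[OF r(1) r'(2) Z(1-3)] N(1) morrey(1) \<open>0 < \<eta>\<close> r(1) a Q
        by (intro fibre_energy_lower_bound[OF Z(1)]) auto
      then show ?thesis by simp
    qed
    define ZZ where "ZZ = (\<Union>w\<in>A. Z w)"
    have fZ: "finite ZZ" using A(1) Z(1) by (simp add: ZZ_def)
    have ZK: "ZZ \<subseteq> K" using Z(2) by (auto simp: ZZ_def)
    \<comment> \<open>Within one fibre this is the choice of the net. For fibres over
      \<open>v\<close> and \<open>w\<close>, the separation \<open>L * r\<close> of the base points
      is at most \<open>L * dist x y\<close>.\<close>
    have sepZ: "separated r ZZ"
      unfolding separated_def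
    proof (intro ballI impI)
      fix x y assume xy: "x \<in> ZZ" "y \<in> ZZ" "x \<noteq> y"
      obtain v w where v: "v \<in> A" "x \<in> Z v" and w: "w \<in> A" "y \<in> Z w"
        using xy by (auto simp: ZZ_def)
      have \<pi>: "\<pi> x = v" "\<pi> y = w" using v w Z(2) by blast+
      show "r \<le> dist x y"
      proof (cases "v = w")
        case True
        then show ?thesis using Z(3)[of v] v w xy(3) unfolding separated_def by blast
      next
        case False
        then have "L * r \<le> dist v w" using A(3) v w unfolding separated_def by blast
        also have "\<dots> \<le> L * dist x y" using Lip[of x y] xy ZK \<pi> by blast
        finally show ?thesis using \<open>0 < L\<close> by simp
      qed
    qed
    have "real (card A) * (c * r powr b) = (\<Sum>w\<in>A. c * r powr b)" by simp
    also have "\<dots> \<le> (\<Sum>w\<in>A. \<Sum>z\<in>Z w. I z)" using A(2) by (intro sum_mono energy) auto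
    also have "\<dots> = (\<Sum>z\<in>ZZ. I z)"
      unfolding ZZ_def
    proof (rule sum.UNION_disjoint[symmetric])
      show "\<forall>v\<in>A. \<forall>w\<in>A. v \<noteq> w \<longrightarrow> Z v \<inter> Z w = {}"
      proof (intro ballI impI equals0I)
        fix v w z assume "v \<noteq> w" "z \<in> Z v \<inter> Z w"
        then show False using Z(2)[of v] Z(2)[of w] by auto
      qed
    qed (use A(1) Z(1) in auto)
    also have "\<dots> \<le> M * J"
    proof -
      have "ennreal (\<Sum>z\<in>ZZ. I z) = (\<Sum>z\<in>ZZ. ennreal (I z))"
        by (rule sum_ennreal[symmetric]) (simp add: I_def)
      also have "\<dots> = (\<Sum>z\<in>ZZ. \<integral>\<^sup>+x\<in>ball z (\<Lambda> * r). h x \<partial>\<mu>)"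
        using ZK by (intro sum.cong refl I) auto
      also have "\<dots> \<le> ennreal M * (\<integral>\<^sup>+x\<in>K'. h x \<partial>\<mu>)"
      proof (rule sum_nn_integral_bounded_overlap[OF metric_measure_sets[OF mm] hm fZ _ K'S])
        show "ball z (\<Lambda> * r) \<subseteq> K'" if "z \<in> ZZ" for z using BK that ZK by blast
        fix x
        \<comment> \<open>The centres of the balls that contain \<open>x\<close> form a separated
          set in \<open>ball x (\<Lambda> * r)\<close>, so packing bounds their number.\<close>
        show "real (card {z \<in> ZZ. x \<in> ball z (\<Lambda> * r)}) \<le> M"
        proof (rule M(3)[OF r(1) r'(3)])
          show "separated r {z \<in> ZZ. x \<in> ball z (\<Lambda> * r)}"
            by (rule separated_subset[OF sepZ]) auto
          show "{z \<in> ZZ. x \<in> ball z (\<Lambda> * r)} \<subseteq> ball x (\<Lambda> * r)" by (auto simp: dist_commute)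
        qed (use fZ ZK in auto)
      qed
      also have "\<dots> = ennreal (M * J)" unfolding J using M(1) by (simp add: ennreal_mult')
      finally show ?thesis using M(1) \<open>0 \<le> J\<close> by (subst (asm) ennreal_le_iff) auto
    qed
    finally have "real (card A) * (c * r powr b) \<le> M * J" .
    then show ?thesis
      using \<open>0 < c\<close> r(1) by (simp add: powr_minus field_simps)
  qed
  have "hausdorff_measure t E = 0"
    by (rule hausdorff_null_of_separated_bound[OF \<open>0 < L\<close> \<open>0 < r0\<close> t(2)[folded b_def] t(1)]) (rule count)
  then show ?thesis unfolding E_def .
qed

section \<open>Exhaustion of the exceptional set by countably many null sets\<close>

theorem theorem1p4:
  fixes \<mu> :: "'x::metric_space measure"
    and \<pi> :: "'x \<Rightarrow> 'w::metric_space"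
    and f :: "'x \<Rightarrow> 'y::metric_space"
    and Q s p \<alpha> :: real
  assumes "Q \<ge> 1" and "0 < s" and "s < Q"
    and "proper_space TYPE('x)" and "metric_measure \<mu>"
    and "locally_homogeneous \<mu> Q" and "local_poincare \<mu> Q"
    and "proper_space TYPE('w)" and "locally_DS_regular \<pi> s"
    and "p > Q"
    and "continuous_on UNIV f"
    and "\<exists>g. upper_gradient f g \<and> Lp_loc \<mu> p g"
    and "s < \<alpha>" and "\<alpha> \<le> p * s / (p - Q + s)"
  shows "hausdorff_dim {a. hausdorff_dim (f ` (\<pi> -` {a})) \<ge> ereal \<alpha>}
           \<le> ereal ((Q - s) - p * (1 - s / \<alpha>))"
proof (rule hausdorff_dim_le)
  obtain g where g: "upper_gradient f g" "Lp_loc \<mu> p g" using assms(12) by blast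
  have pos: "0 < \<alpha>" "0 < p" "0 < p - Q + s" using assms by auto
  \<comment> \<open>The upper limit on \<open>\<alpha>\<close> says exactly that the claimed
    dimension bound is nonnegative.\<close>
  have "\<alpha> * (p - Q + s) \<le> p * s" using assms(14) pos by (simp add: pos_le_divide_eq)
  then show b0: "0 \<le> (Q - s) - p * (1 - s / \<alpha>)" using pos by (simp add: field_simps)
  fix t assume t: "(Q - s) - p * (1 - s / \<alpha>) < t"
  have "0 < t" using b0 t by simp
  \<comment> \<open>Chosen so that the bound at exponent a lies halfway between the bound at \<open>\<alpha>\<close> and t.\<close>
  define e where "e = (t - ((Q - s) - p * (1 - s / \<alpha>))) / 2"
  define a where "a = 1 / (1 / \<alpha> + e / (p * s))"
  have "0 < e" using t by (simp add: e_def)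
  then have "0 < e / (p * s)" using pos assms(2) by simp
  then have inv: "1 / \<alpha> < 1 / a" "1 / a = 1 / \<alpha> + e / (p * s)" by (auto simp: a_def)
  have "0 < a" unfolding a_def zero_less_divide_1_iff using pos(1) \<open>0 < e / (p * s)\<close>
    by (intro add_pos_pos) auto
  have "a < \<alpha>" using inv(1) \<open>0 < a\<close> pos by (simp add: field_simps)
  \<comment> \<open>After clearing the denominator this is \<open>Q < p\<close>.\<close>
  have "p * s / (p - Q + s) < p" using assms pos by (simp add: field_simps)
  then have "a < p" using \<open>a < \<alpha>\<close> assms(14) by simp
  have "s / a = s / \<alpha> + e / p"
    using arg_cong[OF inv(2), of "\<lambda>x. s * x"] assms(2) by (simp add: distrib_left)
  then have "(Q - s) - p * (1 - s / a) = (Q - s) - p * (1 - s / \<alpha>) + e"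
    using pos by (simp add: algebra_simps)
  also have "\<dots> < (Q - s) - p * (1 - s / \<alpha>) + 2 * e" using \<open>0 < e\<close> by simp
  also have "\<dots> = t" unfolding e_def by (simp only: times_divide_eq_right nonzero_mult_div_cancel_left)
  finally have ta: "(Q - s) - p * (1 - s / a) < t" .
  \<comment> \<open>Any base point serves: closed balls around it are compact and exhaust the space.
    In \<open>E n m\<close> the index \<open>m\<close> controls both the threshold and the scale of
    the content.\<close>
  define x0 :: 'x where "x0 = undefined"
  define E where "E n m = {w. ennreal (1 / real (Suc m)) <
      hausdorff_pre a (1 / real (Suc m)) (f ` (\<pi> -` {w} \<inter> cball x0 (real n)))}" for n m
  have "hausdorff_measure t (E n m) = 0" for n m
    unfolding E_def
  proof (rule exceptional_set_null[OF assms(4-7,9) _ assms(1,10,11) g \<open>0 < a\<close> \<open>a < p\<close> _ _ \<open>0 < t\<close> ta])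
    show "compact (cball x0 (real n))" using assms(4) unfolding proper_space_def by blast
  qed simp_all
  then have null: "hausdorff_measure t (\<Union>n. \<Union>m. E n m) = 0"
    by (intro hausdorff_measure_UN_null)
  have "{w. hausdorff_dim (f ` (\<pi> -` {w})) \<ge> ereal \<alpha>} \<subseteq> (\<Union>n. \<Union>m. E n m)"
  proof
    fix w assume "w \<in> {w. hausdorff_dim (f ` (\<pi> -` {w})) \<ge> ereal \<alpha>}"
    then have "ereal a < hausdorff_dim (f ` (\<pi> -` {w}))"
      using \<open>a < \<alpha>\<close> by (auto intro: less_le_trans[of _ "ereal \<alpha>"])
    then have nz: "hausdorff_measure a (f ` (\<pi> -` {w})) \<noteq> 0"
      using \<open>0 < a\<close> by (intro hausdorff_measure_pos_of_dim) auto
    have "f ` (\<pi> -` {w}) \<subseteq> (\<Union>n. f ` (\<pi> -` {w} \<inter> cball x0 (real n)))"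
      using real_arch_simple[of "dist x0 _"] by fastforce
    then obtain n where "hausdorff_measure a (f ` (\<pi> -` {w} \<inter> cball x0 (real n))) \<noteq> 0"
      using nz hausdorff_measure_null_mono[OF hausdorff_measure_UN_null] by metis
    then obtain \<delta> where \<delta>: "0 < \<delta>" "hausdorff_pre a \<delta> (f ` (\<pi> -` {w} \<inter> cball x0 (real n))) \<noteq> 0"
      unfolding hausdorff_measure_eq_0_iff by blast
    define H where "H = hausdorff_pre a \<delta> (f ` (\<pi> -` {w} \<inter> cball x0 (real n)))"
    \<comment> \<open>The content \<open>H\<close> may be infinite; density of the order supplies a
      finite positive value below it.\<close>
    obtain \<eta> where \<eta>: "0 < \<eta>" "ennreal \<eta> < H"
    proof -
      obtain y where "0 < y" "y < H" using dense[of 0 H] \<delta>(2) by (auto simp: H_def zero_less_iff_neq_zero)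
      moreover from this have "y = ennreal (enn2real y)"
        by (metis ennreal_enn2real order.strict_trans2 top_greatest)
      ultimately show ?thesis using that[of "enn2real y"] by (metis ennreal_less_zero_iff)
    qed
    \<comment> \<open>One \<open>m\<close> meets both demands: a scale below \<open>\<delta>\<close>
      can only increase the content, and a threshold below \<open>\<eta>\<close> is easier to
      exceed.\<close>
    obtain m where m: "1 / real (Suc m) < min \<delta> \<eta>"
      using \<delta>(1) \<eta>(1) nat_approx_posE[of "min \<delta> \<eta>"] by auto
    have "ennreal (1 / real (Suc m)) \<le> ennreal \<eta>" using m by (intro ennreal_leI) simp
    also have "\<dots> < H" by fact
    also have "H \<le> hausdorff_pre a (1 / real (Suc m)) (f ` (\<pi> -` {w} \<inter> cball x0 (real n)))"
      unfolding H_def using m by (intro hausdorff_pre_antimono) simp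
    finally show "w \<in> (\<Union>n. \<Union>m. E n m)" by (auto simp: E_def)
  qed
  then show "hausdorff_measure t {w. hausdorff_dim (f ` (\<pi> -` {w})) \<ge> ereal \<alpha>} = 0"
    by (rule hausdorff_measure_null_mono[OF null])
qed


end
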